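(* Let $X$ be a real Banach space. (a) If $X$ is (GM) polyhedral, then the set of $\Delta$-points of $X$ is empty. (b) If $X$ is an $L_1$-predual, then $X$ is (GM) polyhedral if and only if the set of $\Delta$-points of $X$ is empty. (c) More generally, if $X$ is nicely embedded in some $C^b(S)$ space, then $X$ is (GM) polyhedral if and only if the set of $\Delta$-points of $X$ is empty.
   Context: $B_X$, $S_X$ are the closed unit ball and unit sphere, and $\mathrm{ext}(B_{X^*})$ is the set of extreme points of $B_{X^*}$. A real Banach space $X$ is (GM) polyhedral if $x^*(x)<1$ whenever $x\in S_X$ and $x^*\in[\mathrm{ext}(B_{X^*})]'$, where $A'$ is the set of weak-star accumulation points of $A\subseteq X^*$. A point $x\in S_X$ is a $\Delta$-point if for every $\varepsilon>0$ and every slice $S_0$ of $B_X$ containing $x$ (a slice being a set $\{y\in B_X\colon x^*(y)>\sup x^*(B_X)-\alpha\}$ with $x^*\in X^*$, $\alpha>0$) there is $y\in S_0$ with $\|x-y\|>2-\varepsilon$. An $L_1$-predual is a Banach space whose dual is isometrically isomorphic to $L_1(\mu)$ for some positive measure $\mu$. For a Hausdorff topological space $S$, $C^b(S)$ is the sup-normed space of bounded continuous real functions on $S$ and $\delta_s(f)=f(s)$. $X$ is nicely embedded into $C^b(S)$ if there is a linear isometry (into) $J\colon X\to C^b(S)$ such that for all $s\in S$, with $p_s:=J^*(\delta_s)$: (N1) $\|p_s\|=1$; (N2) $\mathbb{R}p_s$ is an $L$-summand in $X^*$, i.e. the range of a linear projection $P$ with $\|x^*\|=\|Px^*\|+\|x^*-Px^*\|$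 for all $x^*\in X^*$. Standing assumption for nicely embedded spaces: the $p_s$, $s\in S$, are pairwise linearly independent. *)

theory Defs
  imports "HOL-Analysis.Analysis"
begin

type_synonym 'a dual = "'a \<Rightarrow>\<^sub>L real"

text \<open>For real-valued operators, the strong operator topology is the topology of pointwise
  convergence on the dual, i.e. the weak-star topology.\<close>

abbreviation weak_star :: "'a::real_normed_vector dual topology" where
  "weak_star \<equiv> strong_operator_topology"

definition GM_polyhedral :: "'a::banach itself \<Rightarrow> bool" where
  "GM_polyhedral _ \<longleftrightarrow>
     (\<forall>x\<in>sphere (0::'a) 1.
        \<forall>f\<in>weak_star derived_set_of {e. e extreme_point_of cball (0::'a dual) 1}.
          blinfun_apply f x < 1)"

definition slice :: "'a::real_normed_vector dual \<Rightarrow> real \<Rightarrow> 'a set" where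
  "slice f \<alpha> =
     {y \<in> cball 0 1. blinfun_apply f y > (SUP z\<in>cball 0 1. blinfun_apply f z) - \<alpha>}"

definition Delta_points :: "'a::banach set" where
  "Delta_points =
     {x \<in> sphere 0 1. \<forall>\<epsilon>>0. \<forall>f. \<forall>\<alpha>>0.
        x \<in> slice f \<alpha> \<longrightarrow> (\<exists>y\<in>slice f \<alpha>. norm (x - y) > 2 - \<epsilon>)}"

text \<open>\<open>T\<close> is a linear isometry of the dual of \<open>'a\<close> onto $L_1(\mu)$. The elements of $L_1(\mu)$ are
  almost-everywhere classes of integrable functions, and \<open>T f\<close> is a representative of the image
  of \<open>f\<close>; so linearity and surjectivity are required almost everywhere.\<close>

definition dual_isometry_onto_L1 ::
  "('a::real_normed_vector dual \<Rightarrow> 'm \<Rightarrow> real) \<Rightarrow> 'm measure \<Rightarrow> bool" where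
  "dual_isometry_onto_L1 T \<mu> \<longleftrightarrow>
     (\<forall>f. integrable \<mu> (T f)) \<and>
     (\<forall>f g. AE t in \<mu>. T (f + g) t = T f t + T g t) \<and>
     (\<forall>c f. AE t in \<mu>. T (c *\<^sub>R f) t = c * T f t) \<and>
     (\<forall>f. (LINT t|\<mu>. \<bar>T f t\<bar>) = norm f) \<and>
     (\<forall>h. integrable \<mu> h \<longrightarrow> (\<exists>f. AE t in \<mu>. T f t = h t))"

text \<open>The existential over the measure is left to the user of this definition, since its
  underlying type \<open>'m\<close> cannot be quantified: a space is an $L_1$-predual if this holds for some
  \<open>\<mu>\<close> on some type.\<close>

definition L1_predual :: "'a::banach itself \<Rightarrow> 'm measure \<Rightarrow> bool" where
  "L1_predual _ \<mu> \<longleftrightarrow> (\<exists>T :: 'a dual \<Rightarrow> 'm \<Rightarrow> real. dual_isometry_onto_L1 T \<mu>)"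

lift_definition dirac :: "'s::topological_space \<Rightarrow> ('s \<Rightarrow>\<^sub>C real) dual"
  is "\<lambda>s f. apply_bcontfun f s"
proof (rule bounded_linear_intro[where K = 1])
  fix s :: 's and f :: "'s \<Rightarrow>\<^sub>C real"
  show "norm (apply_bcontfun f s) \<le> norm f * 1"
    using norm_bounded[of f s] by simp
qed simp_all

definition L_summand :: "'b::real_normed_vector set \<Rightarrow> bool" where
  "L_summand Y \<longleftrightarrow>
     (\<exists>P. linear P \<and> P \<circ> P = P \<and> range P = Y \<and> (\<forall>v. norm v = norm (P v) + norm (v - P v)))"

text \<open>\<open>pullback_dirac J s\<close> is $p_s = J^*(\delta_s)$.\<close>

definition pullback_dirac ::
  "('a::real_normed_vector \<Rightarrow>\<^sub>L ('s::topological_space \<Rightarrow>\<^sub>C real)) \<Rightarrow> 's \<Rightarrow> 'a dual" where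
  "pullback_dirac J s = dirac s o\<^sub>L J"

definition nice_embedding ::
  "('a::banach \<Rightarrow>\<^sub>L ('s::t2_space \<Rightarrow>\<^sub>C real)) \<Rightarrow> bool" where
  "nice_embedding J \<longleftrightarrow>
     (\<forall>x. norm (blinfun_apply J x) = norm x) \<and>
     (\<forall>s. norm (pullback_dirac J s) = 1) \<and>
     (\<forall>s. L_summand (span {pullback_dirac J s}))"

text \<open>Distinctness has to be stated separately, because \<open>{p, q}\<close> collapses to a singleton when
  \<open>p = q\<close>.\<close>

definition pairwise_lin_indep :: "('s \<Rightarrow> 'b::real_vector) \<Rightarrow> bool" where
  "pairwise_lin_indep p \<longleftrightarrow> (\<forall>s t. s \<noteq> t \<longrightarrow> p s \<noteq> p t \<and> independent {p s, p t})"

end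

theory Submission
  imports Defs
begin

text \<open>
  Write \<open>B\<close> for the closed unit ball of the dual and \<open>E\<close> for its set of extreme points. Since \<open>B\<close> is
  weak-star compact and Hausdorff, the space is polyhedral if and only if every unit vector \<open>x\<close> has
  a \<open>\<delta> > 0\<close> for which only finitely many \<open>e \<in> E\<close> satisfy \<open>e x > 1 - \<delta>\<close> (\<open>GM_polyhedral_iff\<close>). All
  three parts are about this finiteness.

  If it holds at \<open>x\<close>, let \<open>D\<close> be the finite set of \<open>e \<in> E\<close> with \<open>e x = 1\<close> and cut a slice with the
  functional \<open>\<Sum>D\<close>. Every \<open>y\<close> in a slice of width 1 has \<open>e y > 0\<close> for all \<open>e \<in> D\<close>, while the other
  extreme points are bounded away from 1 at \<open>x\<close>. As \<open>norm (x - y)\<close> is attained by some \<open>e \<in> E\<close>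
  (\<open>ex_norming_extreme_point\<close>), it stays away from 2, so \<open>x\<close> is not a \<open>\<Delta>\<close>-point.

  For the converses, call \<open>p\<close> an L-functional here if it has norm 1 and the line through it is an
  L-summand of the dual. The key is \<open>Delta_point_if_infinitely_many_L_coefficients\<close>: if for
  every \<open>\<epsilon>\<close> infinitely many L-functionals exceed \<open>1 - \<epsilon>\<close> at the unit vector \<open>x\<close>, then \<open>x\<close> is a
  \<open>\<Delta>\<close>-point. Indeed the L-components of a given functional \<open>g\<close> along different such \<open>p\<close> are
  absolutely summable, so \<open>g = c p + h\<close> with \<open>c\<close> tiny for some \<open>p\<close>. The functional on the dual that agrees
  with \<open>x\<close> on the complement of \<open>p\<close> and takes the value -1 at \<open>p\<close> has norm at most 1, so by Helly's theorem
  some \<open>y\<close> in the ball has \<open>g y\<close> close to \<open>g x\<close> and \<open>p y\<close> close to -1, whence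
  \<open>norm (x - y) \<ge> p x - p y\<close> is almost 2.

  It remains to pass from infinitely many extreme points near 1 to infinitely many L-functionals.
  In an \<open>L\<^sub>1\<close>-predual the nonzero extreme points are themselves L-functionals, being atoms
  (\<open>L_coefficient_extreme_point_L1\<close>). For a nicely embedded space the L-functionals
  norm the space, and a variant of Milman's theorem (\<open>extreme_point_dominated_by_max\<close>,
  \<open>extreme_points_subset_if_finite_norming\<close>) shows the following:
  if a subset of \<open>B\<close> has the norm as its pointwise supremum, and only finitely many of its members exceed
  \<open>1 - \<delta>\<close> at \<open>x\<close>, where \<open>\<delta> \<le> 1\<close>, then every extreme point that exceeds \<open>1 - \<delta>\<close> at \<open>x\<close> is one of them.
\<close>

section \<open>Sublinear functionals and the Hahn--Banach theorem\<close>

definition sublinear :: "('a::real_vector \<Rightarrow> real) \<Rightarrow> bool" where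
  "sublinear p \<longleftrightarrow> (\<forall>x y. p (x + y) \<le> p x + p y) \<and> (\<forall>c\<ge>0. \<forall>x. p (c *\<^sub>R x) = c * p x)"

lemma sublinear_add: "sublinear p \<Longrightarrow> p (x + y) \<le> p x + p y"
  and sublinear_scale: "sublinear p \<Longrightarrow> 0 \<le> c \<Longrightarrow> p (c *\<^sub>R x) = c * p x"
  by (simp_all add: sublinear_def)

lemma sublinear_zero: "sublinear p \<Longrightarrow> p 0 = 0"
  using sublinear_scale[of p 0 0] by simp

lemma sublinear_minus: "sublinear p \<Longrightarrow> - p (- x) \<le> p x"
  using sublinear_add[of p x "- x"] sublinear_zero[of p] by simp

lemma sublinear_norm: "sublinear (norm :: 'a::real_normed_vector \<Rightarrow> real)"
  by (simp add: sublinear_def norm_triangle_ineq)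

lemma sublinear_blinfun: "sublinear (blinfun_apply f)"
  by (simp add: sublinear_def blinfun.add_right blinfun.scaleR_right)

lemma sublinearI:
  assumes add: "\<And>x y. p (x + y) \<le> p x + p y"
    and scale: "\<And>c x. 0 < c \<Longrightarrow> p (c *\<^sub>R x) \<le> c * p x"
    and zero: "p 0 = 0"
  shows "sublinear p"
proof -
  have "p (c *\<^sub>R x) = c * p x" if "0 \<le> c" for c x
  proof (cases "c = 0")
    case False
    with that have c: "0 < c" by simp
    have "p x = p (inverse c *\<^sub>R (c *\<^sub>R x))" using c by simp
    also have "\<dots> \<le> inverse c * p (c *\<^sub>R x)" using scale[of "inverse c" "c *\<^sub>R x"] c by simp
    finally have "c * p x \<le> p (c *\<^sub>R x)" using c by (simp add: field_simps)
    with scale[OF c, of x] show ?thesis by simp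
  qed (simp add: zero)
  with add show ?thesis by (simp add: sublinear_def)
qed

text \<open>A sublinear \<open>p\<close> below the norm is the support functional of the weak-star compact convex set
  of all linear \<open>f \<le> p\<close>. Passing to \<open>localise p y\<close> cuts this set down to its face where \<open>f y\<close> is maximal,
  see \<open>blinfun_le_localise_iff\<close>.\<close>

definition localise :: "('a::real_vector \<Rightarrow> real) \<Rightarrow> 'a \<Rightarrow> 'a \<Rightarrow> real" where
  "localise p y z = (INF t\<in>{0..}. p (z + t *\<^sub>R y) - t * p y)"

lemma bdd_below_localise:
  assumes "sublinear p"
  shows "bdd_below ((\<lambda>t. p (z + t *\<^sub>R y) - t * p y) ` {0..})"
proof (rule bdd_belowI2)
  fix t :: real assume "t \<in> {0..}"
  then have "t * p y = p ((z + t *\<^sub>R y) + (- z))" using sublinear_scale[OF assms] by simp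
  also have "\<dots> \<le> p (z + t *\<^sub>R y) + p (- z)" by (rule sublinear_add[OF assms])
  finally show "- p (- z) \<le> p (z + t *\<^sub>R y) - t * p y" by simp
qed

lemma localise_le_term:
  assumes "sublinear p" "0 \<le> t"
  shows "localise p y z \<le> p (z + t *\<^sub>R y) - t * p y"
  unfolding localise_def by (rule cINF_lower[OF bdd_below_localise[OF assms(1)]]) (simp add: assms)

lemma localise_greatest:
  assumes "\<And>t. 0 \<le> t \<Longrightarrow> a \<le> p (z + t *\<^sub>R y) - t * p y"
  shows "a \<le> localise p y z"
  unfolding localise_def by (rule cINF_greatest) (use assms in auto)

lemma localise_le: "sublinear p \<Longrightarrow> localise p y z \<le> p z"
  using localise_le_term[of p 0] by simp

lemma localise_approx:
  assumes "localise p y z < a"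
  obtains t where "0 \<le> t" "p (z + t *\<^sub>R y) - t * p y < a"
  using assms localise_greatest[of a p z y] by force

lemma sublinear_localise:
  assumes p: "sublinear p"
  shows "sublinear (localise p y)"
proof (rule sublinearI)
  fix u v
  show "localise p y (u + v) \<le> localise p y u + localise p y v"
  proof (rule field_le_epsilon)
    fix e :: real assume "0 < e"
    obtain s where s: "0 \<le> s" "p (u + s *\<^sub>R y) - s * p y < localise p y u + e / 2"
      using localise_approx[of p y u "localise p y u + e / 2"] \<open>0 < e\<close> by auto
    obtain t where t: "0 \<le> t" "p (v + t *\<^sub>R y) - t * p y < localise p y v + e / 2"
      using localise_approx[of p y v "localise p y v + e / 2"] \<open>0 < e\<close> by auto
    have "localise p y (u + v) \<le> p ((u + v) + (s + t) *\<^sub>R y) - (s + t) * p y"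
      using localise_le_term[OF p] s t by simp
    also have "(u + v) + (s + t) *\<^sub>R y = (u + s *\<^sub>R y) + (v + t *\<^sub>R y)"
      by (simp add: algebra_simps)
    also have "p \<dots> \<le> p (u + s *\<^sub>R y) + p (v + t *\<^sub>R y)" by (rule sublinear_add[OF p])
    finally show "localise p y (u + v) \<le> localise p y u + localise p y v + e"
      using s t by (simp add: algebra_simps)
  qed
next
  fix c :: real and u assume c: "0 < c"
  have "localise p y (c *\<^sub>R u) / c \<le> localise p y u"
  proof (rule localise_greatest)
    fix t :: real assume t: "0 \<le> t"
    have "localise p y (c *\<^sub>R u) \<le> p (c *\<^sub>R u + (c * t) *\<^sub>R y) - (c * t) * p y"
      using localise_le_term[OF p] t c by simp
    also have "c *\<^sub>R u + (c * t) *\<^sub>R y = c *\<^sub>R (u + t *\<^sub>R y)" by (simp add: algebra_simps)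
    also have "p \<dots> = c * p (u + t *\<^sub>R y)" using sublinear_scale[OF p] c by simp
    finally show "localise p y (c *\<^sub>R u) / c \<le> p (u + t *\<^sub>R y) - t * p y"
      using c by (simp add: field_simps)
  qed
  then show "localise p y (c *\<^sub>R u) \<le> c * localise p y u" using c by (simp add: field_simps)
next
  show "localise p y 0 = 0"
  proof (rule antisym)
    show "localise p y 0 \<le> 0" using localise_le[OF p, of y 0] sublinear_zero[OF p] by simp
    show "0 \<le> localise p y 0" by (rule localise_greatest) (simp add: sublinear_scale[OF p])
  qed
qed

lemma localise_minus: "sublinear p \<Longrightarrow> localise p y (- y) \<le> - p y"
  using localise_le_term[of p 1 y "- y"] sublinear_zero[of p] by simp

lemma blinfun_le_localise_iff:
  assumes p: "sublinear p"
  shows "(\<forall>z. blinfun_apply f z \<le> localise p y z) \<longleftrightarrow> (\<forall>z. blinfun_apply f z \<le> p z) \<and> blinfun_apply f y = p y"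
proof (intro iffI conjI allI)
  assume *: "\<forall>z. blinfun_apply f z \<le> localise p y z"
  show le: "blinfun_apply f z \<le> p z" for z using * localise_le[OF p, of y z] by (meson order_trans)
  have "blinfun_apply f (- y) \<le> - p y" using * localise_minus[OF p, of y] by (meson order_trans)
  with le[of y] show "blinfun_apply f y = p y" by (simp add: blinfun.minus_right)
next
  fix z
  assume *: "(\<forall>z. blinfun_apply f z \<le> p z) \<and> blinfun_apply f y = p y"
  show "blinfun_apply f z \<le> localise p y z"
  proof (rule localise_greatest)
    fix t :: real
    have "f z + t * f y \<le> p (z + t *\<^sub>R y)"
      using * by (metis blinfun.add_right blinfun.scaleR_right real_scaleR_def)
    with * show "f z \<le> p (z + t *\<^sub>R y) - t * p y" by simp
  qed
qed

text \<open>Chains have enough lower bounds for Zorn's lemma: members are comparable, so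
  any fixed one, at \<open>z\<close> and \<open>- z\<close>, bounds the values of all of them at \<open>z\<close> from below, and near-optimal members
  for \<open>u\<close> and \<open>v\<close> can be replaced by the smaller of them.\<close>

lemma sublinear_chain_INF:
  assumes "C \<noteq> {}" "\<And>p. p \<in> C \<Longrightarrow> sublinear p" 
    and chain: "\<And>p q. p \<in> C \<Longrightarrow> q \<in> C \<Longrightarrow> p \<le> q \<or> q \<le> p"
  shows "sublinear (\<lambda>z. INF p\<in>C. p z)" (is "sublinear ?i")
    and "\<And>p z. p \<in> C \<Longrightarrow> (INF p\<in>C. p z) \<le> p z"
proof -
  obtain p0 where p0: "p0 \<in> C" using assms(1) by blast
  have bdd: "bdd_below ((\<lambda>p. p z) ` C)" for z
  proof (rule bdd_belowI2)
    fix p assume p: "p \<in> C"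
    consider "p \<le> p0" | "p0 \<le> p" using chain[OF p p0] by blast
    then show "- p0 (- z) \<le> p z"
    proof cases
      case 1
      then have "p (- z) \<le> p0 (- z)" by (simp add: le_fun_def)
      with sublinear_minus[OF assms(2)[OF p], of z] show ?thesis by simp
    next
      case 2
      then have "p0 z \<le> p z" by (simp add: le_fun_def)
      with sublinear_minus[OF assms(2)[OF p0], of z] show ?thesis by simp
    qed
  qed
  show lower: "?i z \<le> p z" if "p \<in> C" for p z
    by (rule cINF_lower[OF bdd that])
  have approx: "\<exists>p\<in>C. p z < a" if "?i z < a" for z a
    using that assms(1) bdd by (simp add: cINF_less_iff)
  show "sublinear ?i"
  proof (rule sublinearI)
    fix u v
    show "?i (u + v) \<le> ?i u + ?i v"
    proof (rule field_le_epsilon)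
      fix e :: real assume "0 < e"
      obtain p where p: "p \<in> C" "p u < ?i u + e / 2" using approx[of u "?i u + e / 2"] \<open>0 < e\<close> by auto
      obtain q where q: "q \<in> C" "q v < ?i v + e / 2" using approx[of v "?i v + e / 2"] \<open>0 < e\<close> by auto
      obtain r where r: "r \<in> C" "r \<le> p" "r \<le> q" using chain[OF p(1) q(1)] p q by blast
      have "?i (u + v) \<le> r (u + v)" by (rule lower[OF r(1)])
      also have "\<dots> \<le> r u + r v" by (rule sublinear_add[OF assms(2)[OF r(1)]])
      also have "\<dots> \<le> p u + q v" using r by (simp add: le_fun_def add_mono)
      finally show "?i (u + v) \<le> ?i u + ?i v + e" using p q by simp
    qed
  next
    fix c :: real and u assume c: "0 < c"
    have "?i (c *\<^sub>R u) / c \<le> ?i u"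
    proof (rule cINF_greatest[OF assms(1)])
      fix p assume p: "p \<in> C"
      have "?i (c *\<^sub>R u) \<le> c * p u" using lower[OF p, of "c *\<^sub>R u"] sublinear_scale[OF assms(2)[OF p]] c by simp
      then show "?i (c *\<^sub>R u) / c \<le> p u" using c by (simp add: field_simps)
    qed
    then show "?i (c *\<^sub>R u) \<le> c * ?i u" using c by (simp add: field_simps)
  next
    have "(\<lambda>p. p 0) ` C = {0}" using assms(1,2) sublinear_zero by force
    then show "?i 0 = 0" by simp
  qed
qed

text \<open>One use of Zorn's lemma serves both the Hahn--Banach theorem and the existence of extreme
  points. A minimal member \<open>m\<close> of the family equals all of its localisations, hence satisfies
  \<open>m (- y) = - m y\<close>, and a sublinear functional with this symmetry is linear.\<close>

lemma linear_member_of_family: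
  fixes \<P> :: "('a::real_normed_vector \<Rightarrow> real) set"
  assumes ne: "\<P> \<noteq> {}"
    and sub: "\<And>p. p \<in> \<P> \<Longrightarrow> sublinear p"
    and le: "\<And>p z. p \<in> \<P> \<Longrightarrow> p z \<le> norm z"
    and loc: "\<And>p y. p \<in> \<P> \<Longrightarrow> localise p y \<in> \<P>"
    and inf: "\<And>C. C \<noteq> {} \<Longrightarrow> C \<subseteq> \<P> \<Longrightarrow> (\<And>p q. p \<in> C \<Longrightarrow> q \<in> C \<Longrightarrow> p \<le> q \<or> q \<le> p)
      \<Longrightarrow> (\<lambda>z. INF p\<in>C. p z) \<in> \<P>"
  obtains f :: "'a dual" where "blinfun_apply f \<in> \<P>" "f \<in> cball 0 1"
proof -
  have "\<exists>m\<in>\<P>. \<forall>a\<in>\<P>. a \<le> m \<longrightarrow> a = m"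
  proof (rule predicate_Zorn)
    show "partial_order_on \<P> (relation_of (\<lambda>x y. y \<le> x) \<P>)"
      by (rule partial_order_on_relation_ofI) auto
  next
    fix C assume C: "C \<in> Chains (relation_of (\<lambda>x y. y \<le> x) \<P>)"
    then have CP: "C \<subseteq> \<P>" by (auto simp: Chains_def relation_of_def)
    from C have ch: "p \<le> q \<or> q \<le> p" if "p \<in> C" "q \<in> C" for p q
      using that by (auto simp: Chains_def relation_of_def)
    show "\<exists>u\<in>\<P>. \<forall>a\<in>C. u \<le> a"
    proof (cases "C = {}")
      case False
      have "(\<lambda>z. INF p\<in>C. p z) \<in> \<P>" by (rule inf[OF False CP ch])
      moreover have "\<forall>a\<in>C. (\<lambda>z. INF p\<in>C. p z) \<le> a"
        using sublinear_chain_INF(2)[OF False _ ch] sub CP by (auto simp: le_fun_def)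
      ultimately show ?thesis by blast
    qed (use ne in auto)
  qed
  then obtain m where m: "m \<in> \<P>" and min: "\<And>a. a \<in> \<P> \<Longrightarrow> a \<le> m \<Longrightarrow> a = m" by blast
  note sm = sub[OF m]
  have neg: "m (- y) = - m y" for y
  proof -
    have "localise m y = m" by (rule min[OF loc[OF m]]) (simp add: le_fun_def localise_le[OF sm])
    then show ?thesis using localise_minus[OF sm, of y] sublinear_minus[OF sm, of y] by simp
  qed
  have add: "m (u + v) = m u + m v" for u v
    using sublinear_add[OF sm, of u v] sublinear_add[OF sm, of "- u" "- v"] neg
    by (metis add.inverse_distrib_swap add.commute antisym minus_add_distrib neg_le_iff_le)
  have scale: "m (c *\<^sub>R u) = c * m u" for c u
  proof (cases "0 \<le> c")
    case False
    then have "m ((- c) *\<^sub>R u) = (- c) * m u" by (intro sublinear_scale[OF sm]) simp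
    then show ?thesis using neg[of "c *\<^sub>R u"] by simp
  qed (simp add: sublinear_scale[OF sm])
  have bound: "\<bar>m u\<bar> \<le> norm u" for u
    using le[OF m, of u] le[OF m, of "- u"] neg[of u] by simp
  have bl: "bounded_linear m"
    by (rule bounded_linear_intro[where K = 1]) (use add scale bound in auto)
  show thesis
  proof (rule that)
    show "blinfun_apply (Blinfun m) \<in> \<P>" using m bl by (simp add: bounded_linear_Blinfun_apply)
    show "Blinfun m \<in> cball 0 1"
      using bound by (auto intro!: norm_blinfun_bound simp: bounded_linear_Blinfun_apply[OF bl])
  qed
qed

lemma Hahn_Banach_sublinear:
  fixes r :: "'a::real_normed_vector \<Rightarrow> real"
  assumes r: "sublinear r" and le: "\<And>z. r z \<le> norm z"
  obtains f :: "'a dual" where "\<And>z. f z \<le> r z"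
proof -
  define \<P> where "\<P> = {p. sublinear p \<and> p \<le> r}"
  obtain f :: "'a dual" where "blinfun_apply f \<in> \<P>"
  proof (rule linear_member_of_family[of \<P>])
    show "\<P> \<noteq> {}" using r by (auto simp: \<P>_def)
    show "localise p y \<in> \<P>" if "p \<in> \<P>" for p y
      using that localise_le[of p y] by (auto simp: \<P>_def sublinear_localise le_fun_def intro: order_trans)
    show "(\<lambda>z. INF p\<in>C. p z) \<in> \<P>" if C: "C \<noteq> {}" "C \<subseteq> \<P>"
      and ch: "\<And>p q. p \<in> C \<Longrightarrow> q \<in> C \<Longrightarrow> p \<le> q \<or> q \<le> p" for C
    proof -
      from C have s: "sublinear p" if "p \<in> C" for p using that by (auto simp: \<P>_def)
      obtain q where q: "q \<in> C" using C by blast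
      have "(INF p\<in>C. p z) \<le> r z" for z
        using sublinear_chain_INF(2)[OF C(1) s ch q, of z] q C(2)
        by (auto simp: \<P>_def le_fun_def intro: order_trans)
      with sublinear_chain_INF(1)[OF C(1) s ch] show ?thesis by (auto simp: \<P>_def le_fun_def)
    qed
  qed (use le in \<open>auto simp: \<P>_def le_fun_def intro: order_trans\<close>)
  then show thesis by (intro that) (auto simp: \<P>_def le_fun_def)
qed

lemma blinfun_le_norm: "f \<in> cball (0::'a::real_normed_vector dual) 1 \<Longrightarrow> blinfun_apply f z \<le> norm z"
  using norm_blinfun[of f z] mult_right_mono[of "norm f" 1 "norm z"] by simp

section \<open>Extreme points of the dual ball\<close>

lemma blinfun_eq_if_le:
  fixes f g :: "'a::real_normed_vector dual"
  assumes "\<And>z. f z \<le> g z"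
  shows "f = g"
proof (rule blinfun_eqI)
  fix z show "f z = g z" using assms[of z] assms[of "- z"] by (simp add: blinfun.minus_right)
qed

text \<open>Encodes that the members of the dual unit ball below \<open>p\<close> form a face of it. Only the endpoint \<open>g\<close> needs to be
  mentioned, because exchanging \<open>g\<close> with \<open>h\<close> and \<open>u\<close> with \<open>1 - u\<close> leaves their combination unchanged.\<close>

definition face_functional :: "('a::real_normed_vector \<Rightarrow> real) \<Rightarrow> bool" where
  "face_functional p \<longleftrightarrow>
     (\<forall>g\<in>cball (0::'a dual) 1. \<forall>h\<in>cball 0 1. \<forall>u. 0 < u \<and> u < 1 \<longrightarrow>
        (\<forall>z. blinfun_apply ((1 - u) *\<^sub>R g + u *\<^sub>R h) z \<le> p z) \<longrightarrow> (\<forall>z. g z \<le> p z))"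

lemma face_functionalD:
  assumes "face_functional p" "g \<in> cball 0 1" "h \<in> cball 0 1" "0 < u" "u < 1"
    "\<And>z. blinfun_apply ((1 - u) *\<^sub>R g + u *\<^sub>R h) z \<le> p z"
  shows "g z \<le> p z" "h z \<le> p z"
proof -
  show "g z \<le> p z" using assms unfolding face_functional_def by blast
  have "blinfun_apply ((1 - (1 - u)) *\<^sub>R h + (1 - u) *\<^sub>R g) z \<le> p z" for z
    using assms(6)[of z] by (simp add: add.commute)
  then show "h z \<le> p z"
    using assms unfolding face_functional_def
    by (metis add.commute diff_add_cancel diff_gt_0_iff_gt less_diff_eq less_add_same_cancel1)
qed

lemma face_functional_localise:
  assumes p: "sublinear p" and face: "face_functional p"
  shows "face_functional (localise p y)"
  unfolding face_functional_def
proof (intro ballI allI impI)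
  fix g h :: "'a dual" and u z
  assume gh: "g \<in> cball 0 1" "h \<in> cball 0 1" and u: "0 < u \<and> u < 1"
    and *: "\<forall>z. blinfun_apply ((1 - u) *\<^sub>R g + u *\<^sub>R h) z \<le> localise p y z"
  have **: "(\<forall>z. blinfun_apply ((1 - u) *\<^sub>R g + u *\<^sub>R h) z \<le> p z)" "blinfun_apply ((1 - u) *\<^sub>R g + u *\<^sub>R h) y = p y"
    using * blinfun_le_localise_iff[OF p] by blast+
  have gp: "g z \<le> p z" and hp: "h z \<le> p z" for z
    using face_functionalD[OF face gh, of u z] u ** by blast+
  have eq: "(1 - u) * g y + u * h y = p y"
    using **(2) by (simp add: blinfun.add_left blinfun.scaleR_left)
  have "u * h y \<le> u * p y" using hp[of y] u by simp
  then have "(1 - u) * p y \<le> (1 - u) * g y" using eq by (simp add: algebra_simps)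
  then have "p y \<le> g y" using u by simp
  then have "g y = p y" using gp[of y] by simp
  then show "g z \<le> localise p y z" using blinfun_le_localise_iff[OF p, of g y] gp by blast
qed

text \<open>The Krein--Milman argument in terms of support functionals: among the sublinear functionals that
  describe faces inside the face where \<open>x\<close> is normed there is a linear one, and the face of a linear
  functional is a single point. Infima of chains play the part of intersections of faces.\<close>

lemma ex_norming_extreme_point:
  fixes x :: "'a::real_normed_vector"
  obtains e :: "'a dual" where "e extreme_point_of cball 0 1" "e x = norm x"
proof -
  define \<P> where "\<P> = {p. sublinear p \<and> p \<le> localise norm x \<and> face_functional p}"
  have face0: "face_functional (norm :: 'a \<Rightarrow> real)"
    using blinfun_le_norm by (auto simp: face_functional_def)
  obtain f :: "'a dual" where f: "blinfun_apply f \<in> \<P>" "f \<in> cball 0 1"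
  proof (rule linear_member_of_family[of \<P>])
    show "\<P> \<noteq> {}" using face_functional_localise[OF sublinear_norm face0] sublinear_localise[OF sublinear_norm]
      by (auto simp: \<P>_def)
    show "p z \<le> norm z" if "p \<in> \<P>" for p z
      using that localise_le[OF sublinear_norm, of x z] by (auto simp: \<P>_def le_fun_def intro: order_trans)
    show "localise p y \<in> \<P>" if "p \<in> \<P>" for p y
      using that localise_le[of p y] by (auto simp: \<P>_def sublinear_localise le_fun_def face_functional_localise intro: order_trans)
    show "(\<lambda>z. INF p\<in>C. p z) \<in> \<P>" if C: "C \<noteq> {}" "C \<subseteq> \<P>"
      and ch: "\<And>p q. p \<in> C \<Longrightarrow> q \<in> C \<Longrightarrow> p \<le> q \<or> q \<le> p" for C
    proof -
      from C have s: "sublinear p" if "p \<in> C" for p using that by (auto simp: \<P>_def)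
      have low: "(INF p\<in>C. p z) \<le> q z" if "q \<in> C" for q z
        by (rule sublinear_chain_INF(2)[OF C(1) s ch that])
      obtain q where q: "q \<in> C" using C by blast
      have "(INF p\<in>C. p z) \<le> localise norm x z" for z
        using low[OF q, of z] q C(2) by (auto simp: \<P>_def le_fun_def intro: order_trans)
      moreover have "face_functional (\<lambda>z. INF p\<in>C. p z)"
        unfolding face_functional_def
      proof (intro ballI allI impI)
        fix g h :: "'a dual" and u z
        assume gh: "g \<in> cball 0 1" "h \<in> cball 0 1" and u: "0 < u \<and> u < 1"
          and *: "\<forall>z. blinfun_apply ((1 - u) *\<^sub>R g + u *\<^sub>R h) z \<le> (INF p\<in>C. p z)"
        show "g z \<le> (INF p\<in>C. p z)"
        proof (rule cINF_greatest[OF C(1)])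
          fix p assume p: "p \<in> C"
          then have "face_functional p" using C(2) by (auto simp: \<P>_def)
          then show "g z \<le> p z"
            using face_functionalD(1)[of p g h u z] gh u * low[OF p] by (meson order_trans)
        qed
      qed
      ultimately show ?thesis using sublinear_chain_INF(1)[OF C(1) s ch] by (auto simp: \<P>_def le_fun_def)
    qed
  qed (auto simp: \<P>_def)
  then have le: "\<forall>z. f z \<le> localise norm x z" and face: "face_functional (blinfun_apply f)"
    by (auto simp: \<P>_def le_fun_def)
  have fx: "f x = norm x" using le blinfun_le_localise_iff[OF sublinear_norm, of f x] by blast
  have "f \<notin> open_segment g h" if gh: "g \<in> cball 0 1" "h \<in> cball 0 1" for g h
  proof
    assume "f \<in> open_segment g h"
    then obtain u where u: "0 < u" "u < 1" "f = (1 - u) *\<^sub>R g + u *\<^sub>R h" and ne: "g \<noteq> h"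
      by (auto simp: in_segment)
    have "g z \<le> f z" "h z \<le> f z" for z
      using face_functionalD[OF face gh u(1,2)] u(3) by blast+
    then have "g = f" "h = f" by (auto intro: blinfun_eq_if_le)
    with ne show False by simp
  qed
  with f(2) have "f extreme_point_of cball 0 1" by (auto simp: extreme_point_of_def)
  with fx show thesis by (rule that[rotated])
qed

section \<open>The weak-star topology\<close>

lemma Hausdorff_weak_star: "Hausdorff_space (weak_star :: 'a::real_normed_vector dual topology)"
proof (rule Hausdorff_space_injective_preimage)
  show "continuous_map (weak_star :: 'a dual topology) euclidean blinfun_apply"
    using continuous_map_pullback[of euclidean euclidean id UNIV blinfun_apply]
    by (simp add: strong_operator_topology_def)
  show "inj_on blinfun_apply (topspace (weak_star :: 'a dual topology))"
    by (simp add: inj_on_def blinfun_apply_inject)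
  show "Hausdorff_space (euclidean :: ('a \<Rightarrow> real) topology)"
    unfolding euclidean_product_topology[symmetric] Hausdorff_space_product_topology by simp
qed

text \<open>Banach--Alaoglu: the ball is the continuous image of a closed subset of a product of
  compact intervals.\<close>

lemma compactin_weak_star_cball:
  "compactin weak_star (cball (0 :: 'a::real_normed_vector dual) 1)"
proof -
  define K where "K = PiE UNIV (\<lambda>y::'a. {- norm y..norm y}) \<inter>
    ({\<phi>. \<forall>a b. \<phi> (a + b) = \<phi> a + \<phi> b} \<inter> {\<phi>. \<forall>c a. \<phi> (c *\<^sub>R a) = c * \<phi> a})"
  have lin: "bounded_linear \<phi>" if "\<phi> \<in> K" for \<phi>
    by (rule bounded_linear_intro[where K = 1]) (use that in \<open>auto simp: K_def PiE_iff abs_le_iff minus_le_iff\<close>)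
  have "compactin (product_topology (\<lambda>_. euclidean) UNIV) (PiE UNIV (\<lambda>y::'a. {- norm y..norm y}))"
    by (simp add: compactin_PiE)
  then have "compact (PiE UNIV (\<lambda>y::'a. {- norm y..norm y}))"
    by (simp add: euclidean_product_topology)
  moreover have "closed ({\<phi>::'a \<Rightarrow> real. \<forall>a b. \<phi> (a + b) = \<phi> a + \<phi> b} \<inter> {\<phi>. \<forall>c a. \<phi> (c *\<^sub>R a) = c * \<phi> a})"
    by (intro closed_Int closed_Collect_all closed_Collect_eq continuous_intros
        continuous_on_product_coordinates)
  ultimately have K: "compact K" unfolding K_def by (rule compact_Int_closed)
  have "continuous_map (top_of_set K) weak_star Blinfun"
    unfolding continuous_on_strong_operator_topo_iff_coordinatewise
  proof
    fix x :: 'a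
    have "continuous_on K (\<lambda>\<phi>. \<phi> x)"
      by (intro continuous_on_subset[OF continuous_on_product_coordinates]) simp
    then have "continuous_on K (\<lambda>\<phi>. blinfun_apply (Blinfun \<phi>) x)"
      by (rule continuous_on_eq) (simp add: bounded_linear_Blinfun_apply lin)
    then show "continuous_map (top_of_set K) euclidean (\<lambda>\<phi>. blinfun_apply (Blinfun \<phi>) x)" by simp
  qed
  then have "compactin weak_star (Blinfun ` K)"
    using K by (intro image_compactin) (auto simp: compactin_subtopology)
  moreover have "Blinfun ` K = cball 0 1"
  proof (intro subset_antisym subsetI)
    fix f assume "f \<in> Blinfun ` K"
    then obtain \<phi> where \<phi>: "\<phi> \<in> K" "f = Blinfun \<phi>" by blast
    then have "\<bar>f z\<bar> \<le> norm z" for z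
      by (auto simp: bounded_linear_Blinfun_apply[OF lin[OF \<phi>(1)]] K_def PiE_iff abs_le_iff minus_le_iff)
    then show "f \<in> cball 0 1" by (auto intro!: norm_blinfun_bound)
  next
    fix f :: "'a dual" assume f: "f \<in> cball 0 1"
    have "blinfun_apply f \<in> K"
      using blinfun_le_norm[OF f] blinfun_le_norm[OF f, of "- z" for z]
      by (auto simp: K_def PiE_iff blinfun.add_right blinfun.scaleR_right blinfun.minus_right minus_le_iff)
    then show "f \<in> Blinfun ` K" by (metis blinfun_apply_inverse image_eqI)
  qed
  ultimately show ?thesis by simp
qed

lemma openin_weak_star_halfspace: "openin weak_star {g :: 'a::real_normed_vector dual. a < blinfun_apply g x}"
  using strong_operator_topology_basis[of "{()}" "\<lambda>_. {a<..}" "\<lambda>_. x"] by simp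

lemma openin_weak_star_halfspace': "openin weak_star {g :: 'a::real_normed_vector dual. blinfun_apply g x < a}"
  using strong_operator_topology_basis[of "{()}" "\<lambda>_. {..<a}" "\<lambda>_. x"] by simp

text \<open>Near an accumulation point there are infinitely many extreme points, which gives one
  direction. For the other, every functional has a weak-star neighbourhood that contains only
  finitely many of the extreme points \<open>e\<close> with \<open>e x > 1 - \<delta>\<close>, for some \<open>\<delta>\<close> depending on the neighbourhood;
  compactness of the ball makes \<open>\<delta>\<close> uniform.\<close>

lemma GM_polyhedral_iff:
  "GM_polyhedral TYPE('a::banach) \<longleftrightarrow>
     (\<forall>x\<in>sphere (0::'a) 1. \<exists>\<delta>>0. finite {e :: 'a dual. e extreme_point_of cball 0 1 \<and> 1 - \<delta> < blinfun_apply e x})"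
  (is "_ \<longleftrightarrow> (\<forall>x\<in>_. \<exists>\<delta>>0. finite (?F x \<delta>))")
proof (intro iffI ballI)
  let ?E = "{e :: 'a dual. e extreme_point_of cball 0 1}"
  fix x :: 'a assume GM: "GM_polyhedral TYPE('a)" and x: "x \<in> sphere 0 1"
  define \<U> where "\<U> = {U. openin weak_star U \<and> (\<exists>\<delta>>0. finite (U \<inter> ?F x \<delta>))}"
  have cover: "\<exists>U\<in>\<U>. f \<in> U" for f :: "'a dual"
  proof (cases "f x < 1")
    case True
    define U where "U = {g :: 'a dual. blinfun_apply g x < (1 + f x) / 2}"
    have "U \<inter> ?F x ((1 - f x) / 2) = {}" by (auto simp: U_def field_simps)
    moreover have "(1 - f x) / 2 > 0" "f \<in> U" using True by (simp_all add: U_def)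
    ultimately show ?thesis using openin_weak_star_halfspace'[of x "(1 + f x) / 2"]
      unfolding \<U>_def U_def[symmetric] by (intro bexI[of _ U] CollectI conjI exI[of _ "(1 - f x) / 2"]) auto
  next
    case False
    then have "f \<notin> weak_star derived_set_of ?E" using GM x unfolding GM_polyhedral_def by blast
    then obtain U where U: "f \<in> U" "openin weak_star U" "finite (?E \<inter> U)"
      unfolding derived_set_of_infinite_openin[OF Hausdorff_weak_star]
      by (auto simp: strong_operator_topology_topspace)
    then have "finite (U \<inter> ?F x 1)" by (rule_tac finite_subset[of _ "?E \<inter> U"]) auto
    then have "U \<in> \<U>" using U unfolding \<U>_def by (auto intro: exI[of _ 1])
    with U show ?thesis by blast
  qed
  have "\<And>U. U \<in> \<U> \<Longrightarrow> openin weak_star U" by (simp add: \<U>_def)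
  then obtain \<F> where \<F>: "finite \<F>" "\<F> \<subseteq> \<U>" "cball 0 1 \<subseteq> \<Union>\<F>"
    using compactin_weak_star_cball[where 'a='a] cover unfolding compactin_def by (metis (no_types, lifting) Union_iff subsetI)
  have "\<exists>\<delta>>0. finite (\<Union>\<F> \<inter> ?F x \<delta>)"
    using \<F>(1,2)
  proof (induction \<F>)
    case empty
    then show ?case by (auto intro: exI[of _ 1])
  next
    case (insert U \<F>)
    then obtain \<delta> \<delta>' where \<delta>: "\<delta> > 0" "finite (\<Union>\<F> \<inter> ?F x \<delta>)" "\<delta>' > 0" "finite (U \<inter> ?F x \<delta>')"
      by (auto simp: \<U>_def)
    then have "finite (\<Union>(insert U \<F>) \<inter> ?F x (min \<delta> \<delta>'))"
      by (rule_tac finite_subset[of _ "\<Union>\<F> \<inter> ?F x \<delta> \<union> U \<inter> ?F x \<delta>'"]) auto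
    then show ?case using \<delta> by (intro exI[of _ "min \<delta> \<delta>'"] conjI) simp_all
  qed
  moreover have "?F x \<delta> \<subseteq> \<Union>\<F>" for \<delta> using \<F>(3) by (auto simp: extreme_point_of_def)
  ultimately show "\<exists>\<delta>>0. finite (?F x \<delta>)" by (metis inf.absorb_iff2)
next
  let ?E = "{e :: 'a dual. e extreme_point_of cball 0 1}"
  assume *: "\<forall>x\<in>sphere 0 1. \<exists>\<delta>>0. finite (?F x \<delta>)"
  show "GM_polyhedral TYPE('a)"
    unfolding GM_polyhedral_def
  proof (intro ballI)
    fix x :: 'a and f assume x: "x \<in> sphere 0 1" and f: "f \<in> weak_star derived_set_of ?E"
    obtain \<delta> where \<delta>: "\<delta> > 0" "finite (?F x \<delta>)" using * x by blast
    show "f x < 1"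
    proof (rule ccontr)
      assume "\<not> f x < 1"
      then have "infinite (?E \<inter> {g. 1 - \<delta> < blinfun_apply g x})"
        using f openin_weak_star_halfspace[of "1 - \<delta>" x] \<delta>(1)
        unfolding derived_set_of_infinite_openin[OF Hausdorff_weak_star] by auto
      with \<delta>(2) show False by (simp add: Int_def)
    qed
  qed
qed

section \<open>Polyhedral spaces have no $\Delta$-points\<close>

lemma SUP_cball_upper:
  fixes f :: "'a::real_normed_vector dual"
  assumes "z \<in> cball 0 1"
  shows "f z \<le> (SUP z\<in>cball 0 1. f z)"
proof (rule cSUP_upper[OF assms bdd_aboveI2])
  fix z :: 'a assume z: "z \<in> cball 0 1"
  have "f z \<le> norm f * norm z" using norm_blinfun[of f z] by simp
  also have "\<dots> \<le> norm f" using z by (simp add: mult_left_le)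
  finally show "f z \<le> norm f" .
qed

text \<open>The slice is cut by the sum of the finitely many extreme points that norm \<open>x\<close>, so on it each
  of them is positive. The constant \<open>m\<close> separates the values of the remaining
  extreme points at \<open>x\<close> from 1.\<close>

lemma GM_polyhedral_imp_no_Delta_points:
  assumes "GM_polyhedral TYPE('a::banach)"
  shows "(Delta_points :: 'a set) = {}"
proof (rule ccontr)
  assume "(Delta_points :: 'a set) \<noteq> {}"
  then obtain x :: 'a where x: "x \<in> Delta_points" by blast
  then have nx: "norm x = 1" by (simp add: Delta_points_def)
  define E :: "'a dual set" where "E = {e. e extreme_point_of cball 0 1}"
  obtain \<delta> where \<delta>: "\<delta> > 0" "finite {e\<in>E. 1 - \<delta> < blinfun_apply e x}" 
    using assms nx unfolding GM_polyhedral_iff E_def by (auto dest!: bspec[of _ _ x])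
  define F where "F = {e\<in>E. 1 - \<delta> < blinfun_apply e x}"
  have le1: "e z \<le> norm z" if "e \<in> E" for e z
    using that blinfun_le_norm by (auto simp: E_def extreme_point_of_def)
  define D where "D = {e\<in>F. blinfun_apply e x = 1}"
  \<comment> \<open>The entry 0 makes the bound \<open>1 + m\<close> below also cover the case \<open>e \<in> D\<close>.\<close>
  define m where "m = Max (insert 0 (insert (1 - \<delta>) ((\<lambda>e. blinfun_apply e x) ` (F - D))))"
  have finF: "finite F" using \<delta>(2) by (simp add: F_def)
  have m0: "0 \<le> m" unfolding m_def using finF by (intro Max_ge) auto
  have "e x < 1" if "e \<in> F - D" for e
    using that le1[of e x] nx by (auto simp: D_def F_def)
  then have m1: "m < 1" unfolding m_def using finF \<delta>(1) by (subst Max_less_iff) auto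
  have gap: "e x \<le> m" if "e \<in> E" "e \<notin> D" for e
  proof (cases "e \<in> F")
    case True
    then show ?thesis unfolding m_def using that finF by (intro Max_ge) auto
  next
    case False
    then have "e x \<le> 1 - \<delta>" using that by (auto simp: F_def)
    also have "\<dots> \<le> m" unfolding m_def using finF by (intro Max_ge) auto
    finally show ?thesis .
  qed
  have D: "finite D" "D \<subseteq> E" "\<And>e. e \<in> D \<Longrightarrow> e x = 1" using finF unfolding D_def by (simp, auto simp: F_def)
  define f where "f = (\<Sum>e\<in>D. e)"
  have f: "f z = (\<Sum>e\<in>D. blinfun_apply e z)" for z by (simp add: f_def blinfun.sum_left)
  have le_one: "e z \<le> 1" if "e \<in> D" "norm z \<le> 1" for e z
    using le1[of e z] that D(2) by (meson order_trans subsetD)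
  have fx: "f x = real (card D)" using D by (simp add: f)
  have "(SUP z\<in>cball 0 1. f z) \<le> real (card D)"
  proof (rule cSUP_least)
    fix z :: 'a assume "z \<in> cball 0 1"
    then have "f z \<le> (\<Sum>e\<in>D. 1)" unfolding f by (intro sum_mono le_one) simp_all
    then show "f z \<le> real (card D)" by simp
  qed simp
  then have SUP: "(SUP z\<in>cball 0 1. f z) = real (card D)"
    using SUP_cball_upper[of x f] fx nx by simp
  then have "x \<in> slice f 1" using nx fx by (simp add: slice_def)
  then obtain y where y: "y \<in> slice f 1" "norm (x - y) > 2 - (1 - m)"
    using x m1 unfolding Delta_points_def mem_Collect_eq by (meson diff_gt_0_iff_gt zero_less_one)
  have ny: "norm y \<le> 1" and fy: "f y > real (card D) - 1" using y(1) SUP by (auto simp: slice_def)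
  obtain e where e: "e \<in> E" "e (x - y) = norm (x - y)"
    using ex_norming_extreme_point[of "x - y"] by (auto simp: E_def)
  have ey: "- e y \<le> 1" using le1[OF e(1), of "- y"] ny by (simp add: blinfun.minus_right)
  have "norm (x - y) = e x - e y" using e by (simp add: blinfun.diff_right)
  also have "\<dots> \<le> 1 + m"
  proof (cases "e \<in> D")
    case True
    have "f y = e y + (\<Sum>e\<in>D - {e}. blinfun_apply e y)" unfolding f using D True by (simp add: sum.remove)
    also have "(\<Sum>e\<in>D - {e}. blinfun_apply e y) \<le> (\<Sum>e\<in>D - {e}. 1)"
      using ny by (intro sum_mono le_one) simp_all
    also have "(\<Sum>e\<in>D - {e}. 1) = (\<Sum>e\<in>D. 1) - (1::real)"  using D(1) True by (subst sum_diff1) auto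
    finally have "e y > 0" using fy by simp
    with D(3)[OF True] m0 show ?thesis by simp
  next
    case False
    with gap[OF e(1)] ey show ?thesis by simp
  qed
  finally show False using y(2) by simp
qed

section \<open>L-summands and $\Delta$-points\<close>

lemma norm_blinfun_le:
  fixes f :: "'a::real_normed_vector dual"
  assumes "\<And>y. norm y \<le> 1 \<Longrightarrow> f y \<le> b"
  shows "norm f \<le> b"
proof -
  have b: "0 \<le> b" using assms[of 0] by simp
  have le: "f y \<le> b * norm y" for y
  proof (cases "y = 0")
    case False
    then have "f (y /\<^sub>R norm y) \<le> b" by (intro assms) simp
    with False show ?thesis by (simp add: blinfun.scaleR_right field_simps)
  qed simp
  have "\<bar>f y\<bar> \<le> b * norm y" for y using le[of y] le[of "- y"] by (simp add: blinfun.minus_right)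
  with b show ?thesis by (intro norm_blinfun_bound) auto
qed

text \<open>Helly's theorem for two functionals: a point of the plane outside the closure of the image
  of the ball is strictly separated from it by a line, and the normal \<open>(- s, - t)\<close> of this line violates the bound.\<close>

lemma Helly_two_functionals:
  fixes f g :: "'a::real_normed_vector dual"
  assumes bound: "\<And>s t. s * a + t * b \<le> norm (s *\<^sub>R f + t *\<^sub>R g)" and "0 < \<theta>"
  obtains y where "norm y \<le> 1" "\<bar>f y - a\<bar> < \<theta>" "\<bar>g y - b\<bar> < \<theta>"
proof -
  define \<Phi> where "\<Phi> y = (f y, g y)" for y
  have "linear \<Phi>" unfolding \<Phi>_def
    by (rule linearI) (simp_all add: blinfun.add_right blinfun.scaleR_right)
  then have conv: "convex (closure (\<Phi> ` cball 0 1))"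
    by (intro convex_closure convex_linear_image convex_cball)
  have "(a, b) \<in> closure (\<Phi> ` cball 0 1)"
  proof (rule ccontr)
    assume "(a, b) \<notin> closure (\<Phi> ` cball 0 1)"
    then obtain u \<beta> where u: "inner u (a, b) < \<beta>" "\<forall>z\<in>closure (\<Phi> ` cball 0 1). \<beta> < inner u z"
      using separating_hyperplane_closed_point[OF conv closed_closure] by blast
    obtain s t where st: "u = (s, t)" by (cases u)
    have "norm ((- s) *\<^sub>R f + (- t) *\<^sub>R g) \<le> - \<beta>"
    proof (rule norm_blinfun_le)
      fix y :: 'a assume "norm y \<le> 1"
      then have "\<Phi> y \<in> closure (\<Phi> ` cball 0 1)"
        by (intro subsetD[OF closure_subset]) auto
      with u(2) have "\<beta> < inner u (\<Phi> y)" by blast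
      then show "blinfun_apply ((- s) *\<^sub>R f + (- t) *\<^sub>R g) y \<le> - \<beta>"
        by (simp add: st \<Phi>_def blinfun.add_left blinfun.scaleR_left blinfun.minus_left blinfun.diff_left)
    qed
    with bound[of "- s" "- t"] u(1) show False by (simp add: st)
  qed
  then obtain y where y: "norm y \<le> 1" "dist (\<Phi> y) (a, b) < \<theta>"
    using \<open>0 < \<theta>\<close> unfolding closure_approachable by auto
  with dist_fst_le[of "\<Phi> y" "(a, b)"] dist_snd_le[of "\<Phi> y" "(a, b)"] show thesis
    by (intro that) (auto simp: \<Phi>_def dist_real_def)
qed

text \<open>The L-projection onto the line through the unit vector \<open>p\<close> is \<open>v \<mapsto> c v *\<^sub>R p\<close>; it is
  easier to compute with its coefficient.\<close>

definition L_coefficient :: "'b::real_normed_vector \<Rightarrow> ('b \<Rightarrow> real) \<Rightarrow> bool" where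
  "L_coefficient p c \<longleftrightarrow> linear c \<and> norm p = 1 \<and> c p = 1 \<and>
     (\<forall>v. norm v = \<bar>c v\<bar> + norm (v - c v *\<^sub>R p))"

text \<open>The last rule is stated pointwise because, as a quantified equation, it would rewrite
  norms for ever.\<close>

lemma L_coefficientD:
  assumes "L_coefficient p c"
  shows "linear c" "norm p = 1" "c p = 1" "norm v = \<bar>c v\<bar> + norm (v - c v *\<^sub>R p)"
proof -
  note * = assms[unfolded L_coefficient_def]
  show "linear c" by (rule conjunct1[OF *])
  show "norm p = 1" by (rule conjunct1[OF conjunct2[OF *]])
  show "c p = 1" by (rule conjunct1[OF conjunct2[OF conjunct2[OF *]]])
  show "norm v = \<bar>c v\<bar> + norm (v - c v *\<^sub>R p)"
    by (rule spec[OF conjunct2[OF conjunct2[OF conjunct2[OF *]]]])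
qed

lemma L_coefficient_if_L_summand:
  assumes "L_summand (span {p})" and p: "norm p = 1"
  obtains c where "L_coefficient p c"
proof -
  obtain P where P: "linear P" "P \<circ> P = P" "range P = span {p}"
    and norm_eq: "\<And>v. norm v = norm (P v) + norm (v - P v)"
    using assms(1) unfolding L_summand_def by blast
  have "\<exists>k. P v = k *\<^sub>R p" for v using P(3) by (auto simp: span_singleton)
  then obtain c where c: "\<And>v. P v = c v *\<^sub>R p" by metis
  have p0: "p \<noteq> 0" using p by auto
  have "linear c"
  proof (rule linearI)
    show "c (u + v) = c u + c v" for u v
      using linear_add[OF P(1), of u v] p0 by (simp add: c flip: scaleR_add_left)
    show "c (k *\<^sub>R v) = k *\<^sub>R c v" for k v
      using linear_scale[OF P(1), of k v] p0 by (simp add: c)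
  qed
  moreover have "c p = 1"
  proof -
    have "p \<in> range P" by (simp add: P(3) span_base)
    then obtain v where "p = P v" by blast
    then have "P p = p" using P(2) by (metis comp_apply)
    then show ?thesis using c[of p] p0 by (metis scaleR_cancel_right scaleR_one)
  qed
  moreover have "norm v = \<bar>c v\<bar> + norm (v - c v *\<^sub>R p)" for v
    using norm_eq[of v] unfolding c norm_scaleR p mult_1_right .
  ultimately have "L_coefficient p c" using p unfolding L_coefficient_def by (intro conjI allI)
  then show thesis by (rule that)
qed

text \<open>Apply \<open>d\<close> to the decomposition of \<open>q\<close> along \<open>p\<close>. As \<open>d q = 1\<close> while \<open>d\<close> is a contraction and the
  two parts of \<open>q\<close> have norms with sum 1, nothing may be lost: a nonzero part along \<open>p\<close> forces
  \<open>\<bar>d p\<bar> = 1\<close>, which means that \<open>p\<close> lies on the line through \<open>q\<close>.\<close>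

lemma L_coefficient_orthogonal:
  assumes p: "L_coefficient p c" and q: "L_coefficient q d"
    and ne: "p \<noteq> q" "p \<noteq> - q"
  shows "c q = 0"
proof (rule ccontr)
  assume c0: "c q \<noteq> 0"
  have dle: "\<bar>d v\<bar> \<le> norm v" for v
    using L_coefficientD(4)[OF q, of v] norm_ge_zero[of "v - d v *\<^sub>R q"] by linarith
  note lin = L_coefficientD(1)[OF q]
  note np = L_coefficientD(4)[OF q, of p] L_coefficientD(2)[OF p]
  note nq = L_coefficientD(4)[OF p, of q] L_coefficientD(2)[OF q]
  have "1 = d q" by (simp add: L_coefficientD(3)[OF q])
  also have "\<dots> = c q * d p + d (q - c q *\<^sub>R p)"
    by (simp add: linear_diff[OF lin] linear_scale[OF lin])
  also have "\<dots> \<le> \<bar>c q\<bar> * \<bar>d p\<bar> + norm (q - c q *\<^sub>R p)"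
    using dle[of "q - c q *\<^sub>R p"] by (simp add: abs_mult[symmetric] add_mono)
  finally have "\<bar>c q\<bar> * 1 \<le> \<bar>c q\<bar> * \<bar>d p\<bar>" using nq by linarith
  then have "1 \<le> \<bar>d p\<bar>" using c0 mult_le_cancel_left_pos[of "\<bar>c q\<bar>" 1 "\<bar>d p\<bar>"] by simp
  then have "norm (p - d p *\<^sub>R q) = 0" "\<bar>d p\<bar> = 1" using np norm_ge_zero[of "p - d p *\<^sub>R q"] by linarith+
  then have "p = d p *\<^sub>R q" "d p = 1 \<or> d p = - 1" by auto
  with ne show False by (metis scaleR_minus1_left scaleR_one)
qed

text \<open>By orthogonality, splitting off one more line does not change the components that were
  already removed.\<close>

lemma sum_L_coefficients_plus_remainder:
  assumes "finite F" and c: "\<And>p. p \<in> F \<Longrightarrow> L_coefficient p (c p)"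
    and ne: "\<And>p q. p \<in> F \<Longrightarrow> q \<in> F \<Longrightarrow> p \<noteq> - q"
  shows "(\<Sum>p\<in>F. \<bar>c p v\<bar>) + norm (v - (\<Sum>p\<in>F. c p v *\<^sub>R p)) = norm v"
  using assms
proof (induction F)
  case (insert q F)
  define r where "r = v - (\<Sum>p\<in>F. c p v *\<^sub>R p)"
  have q: "L_coefficient q (c q)" using insert.prems by simp
  note lin = L_coefficientD(1)[OF q]
  have "c q p = 0" if "p \<in> F" for p
    by (rule L_coefficient_orthogonal[OF q]) (use that insert in auto)
  then have "c q r = c q v"
    by (simp add: r_def linear_diff[OF lin] linear_sum[OF lin] linear_scale[OF lin])
  moreover have "norm r = \<bar>c q r\<bar> + norm (r - c q r *\<^sub>R q)" by (rule L_coefficientD(4)[OF q])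
  moreover have "(\<Sum>p\<in>F. \<bar>c p v\<bar>) + norm r = norm v"
    unfolding r_def by (rule insert.IH) (use insert.prems in auto)
  ultimately show ?case using insert.hyps by (simp add: r_def algebra_simps)
qed simp

text \<open>Infinitely many disjoint L-components of \<open>g\<close> cannot all have size at least \<open>\<gamma> / 4\<close>, so \<open>x\<close> can be
  modified in the direction of some \<open>p\<close> at almost no cost for \<open>g\<close>. The admissibility condition of
  Helly's theorem is exactly the L-decomposition of \<open>s g + t p\<close>.\<close>

proposition Delta_point_if_infinitely_many_L_coefficients:
  fixes x :: "'a::banach"
  assumes x: "norm x = 1"
    and inf: "\<And>\<epsilon>. 0 < \<epsilon> \<Longrightarrow> infinite {p::'a dual. (\<exists>c. L_coefficient p c) \<and> 1 - \<epsilon> < blinfun_apply p x}"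
  shows "x \<in> Delta_points"
  unfolding Delta_points_def
proof (intro CollectI conjI allI impI)
  show "x \<in> sphere 0 1" using x by simp
  fix \<epsilon> :: real and g :: "'a dual" and \<alpha> :: real
  assume \<epsilon>: "0 < \<epsilon>" and \<alpha>: "0 < \<alpha>" and slice: "x \<in> slice g \<alpha>"
  define M where "M = (SUP z\<in>cball 0 1. g z)"
  define \<gamma> where "\<gamma> = g x - (M - \<alpha>)"
  have \<gamma>: "0 < \<gamma>" using slice by (simp add: slice_def \<gamma>_def M_def)
  define \<theta> where "\<theta> = min (min (\<epsilon> / 2) 1) (\<gamma> / 4)"
  have \<theta>: "0 < \<theta>" "\<theta> \<le> \<epsilon> / 2" "\<theta> \<le> 1" "\<theta> \<le> \<gamma> / 4" using \<epsilon> \<gamma> by (auto simp: \<theta>_def)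
  define A where "A = {p::'a dual. (\<exists>c. L_coefficient p c) \<and> 1 - \<theta> < blinfun_apply p x}"
  define C where "C p = (SOME c. L_coefficient p c)" for p :: "'a dual"
  have C: "L_coefficient p (C p)" if "p \<in> A" for p
    using that someI_ex[of "L_coefficient p"] unfolding C_def A_def by blast
  \<comment> \<open>Since \<open>\<theta> \<le> 1\<close>, all members of \<open>A\<close> are positive at \<open>x\<close>.\<close>
  have ne: "p \<noteq> - q" if "p \<in> A" "q \<in> A" for p q
    using that \<theta>(3) by (auto simp: A_def blinfun.minus_left)
  obtain p where p: "p \<in> A" "\<bar>C p g\<bar> < \<gamma> / 4"
  proof (rule ccontr)
    assume "\<not> thesis"
    with that have ge: "\<gamma> / 4 \<le> \<bar>C p g\<bar>" if "p \<in> A" for p using that by force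
    obtain n :: nat where n: "norm g < n * (\<gamma> / 4)" using \<gamma> reals_Archimedean3[of "\<gamma> / 4"] by auto
    have "infinite A" using inf[OF \<theta>(1)] by (simp add: A_def)
    then obtain F where F: "F \<subseteq> A" "finite F" "card F = n" by (meson infinite_arbitrarily_large)
    have "n * (\<gamma> / 4) \<le> (\<Sum>p\<in>F. \<bar>C p g\<bar>)"
      using sum_mono[of F "\<lambda>_. \<gamma> / 4" "\<lambda>p. \<bar>C p g\<bar>"] ge F by (auto simp: subset_iff)
    also have "\<dots> \<le> norm g"
      using sum_L_coefficients_plus_remainder[of F C g] F C ne norm_ge_zero[of "g - (\<Sum>p\<in>F. C p g *\<^sub>R p)"]
      by (smt (verit) subset_iff)
    finally show False using n by simp
  qed
  define c where "c = C p g"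
  define h where "h = g - c *\<^sub>R p"
  have L: "L_coefficient p (C p)" using C[OF p(1)] .
  note lin = L_coefficientD(1)[OF L] and np = L_coefficientD(2)[OF L]
    and Cp = L_coefficientD(3)[OF L] and nv = L_coefficientD(4)[OF L]
  have g: "g = c *\<^sub>R p + h" by (simp add: h_def)
  have "s * (h x - c) + t * (- 1) \<le> norm (s *\<^sub>R g + t *\<^sub>R p)" for s t
  proof -
    have Cv: "C p (s *\<^sub>R g + t *\<^sub>R p) = s * c + t"
      by (simp add: linear_add[OF lin] linear_scale[OF lin] Cp c_def)
    have "s *\<^sub>R g + t *\<^sub>R p - (s * c + t) *\<^sub>R p = s *\<^sub>R h" by (simp add: h_def algebra_simps)
    then have "norm (s *\<^sub>R g + t *\<^sub>R p) = \<bar>s * c + t\<bar> + norm (s *\<^sub>R h)"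
      using nv[of "s *\<^sub>R g + t *\<^sub>R p"] unfolding Cv by metis
    moreover have "s * h x \<le> norm (s *\<^sub>R h)"
      using norm_blinfun[of "s *\<^sub>R h" x] x by (simp add: blinfun.scaleR_left)
    ultimately show ?thesis by (simp add: algebra_simps)
  qed
  from Helly_two_functionals[OF this \<theta>(1)] obtain y
    where y: "norm y \<le> 1" "\<bar>g y - (h x - c)\<bar> < \<theta>" "\<bar>p y - (- 1)\<bar> < \<theta>" .
  have "c * p x \<le> \<bar>c\<bar>"
  proof -
    have "\<bar>p x\<bar> \<le> 1" using norm_blinfun[of p x] np x by simp
    then have "\<bar>c * p x\<bar> \<le> \<bar>c\<bar>" by (simp add: abs_mult mult_left_le)
    then show ?thesis by simp
  qed
  then have "h x - c \<ge> g x - 2 * \<bar>c\<bar>"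
    by (simp add: h_def blinfun.diff_left blinfun.scaleR_left)
  then have "g y > g x - \<gamma>" using y(2) \<theta>(4) p(2) by (simp add: c_def)
  then have "y \<in> slice g \<alpha>" using y(1) by (simp add: slice_def \<gamma>_def M_def)
  moreover have "2 - \<epsilon> < norm (x - y)"
  proof -
    have "2 - \<epsilon> < p x - p y" using p(1) y(3) \<theta>(2) by (auto simp: A_def)
    also have "\<dots> \<le> norm (x - y)" using norm_blinfun[of p "x - y"] np by (simp add: blinfun.diff_right)
    finally show ?thesis .
  qed
  ultimately show "\<exists>y\<in>slice g \<alpha>. 2 - \<epsilon> < norm (x - y)" by blast
qed

text \<open>The common part of both converses: what depends on the space is only how extreme points near 1 are
  controlled by L-functionals near 1.\<close>

lemma GM_polyhedral_if_no_Delta_points: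
  assumes no: "(Delta_points :: 'a::banach set) = {}"
    and ext: "\<And>x \<delta>. norm (x::'a) = 1 \<Longrightarrow> 0 < \<delta> \<Longrightarrow> \<delta> < 1 \<Longrightarrow>
      finite {p::'a dual. (\<exists>c. L_coefficient p c) \<and> 1 - \<delta> < blinfun_apply p x} \<Longrightarrow>
      finite {e::'a dual. e extreme_point_of cball 0 1 \<and> 1 - \<delta> < blinfun_apply e x}"
  shows "GM_polyhedral TYPE('a)"
  unfolding GM_polyhedral_iff
proof
  fix x :: 'a assume x: "x \<in> sphere 0 1"
  let ?A = "\<lambda>\<delta>. {p::'a dual. (\<exists>c. L_coefficient p c) \<and> 1 - \<delta> < blinfun_apply p x}"
  obtain \<delta> where \<delta>: "0 < \<delta>" "finite (?A \<delta>)"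
    using Delta_point_if_infinitely_many_L_coefficients[of x] no x by auto
  have "finite (?A (min \<delta> (1/2)))" by (rule finite_subset[OF _ \<delta>(2)]) auto
  then have "finite {e::'a dual. e extreme_point_of cball 0 1 \<and> 1 - min \<delta> (1/2) < blinfun_apply e x}"
    using x \<delta>(1) by (intro ext) auto
  moreover have "0 < min \<delta> (1/2)" using \<delta>(1) by simp
  ultimately show "\<exists>\<delta>>0. finite {e::'a dual. e extreme_point_of cball 0 1 \<and> 1 - \<delta> < blinfun_apply e x}"
    by blast
qed

section \<open>$L_1$-preduals\<close>

lemma norm_extreme_point_eq_1:
  assumes "e extreme_point_of cball 0 1" "e \<noteq> 0"
  shows "norm e = 1"
proof (rule ccontr)
  assume "norm e \<noteq> 1"
  then have lt: "norm e < 1" using assms(1) by (simp add: extreme_point_of_def)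
  have "e = norm e *\<^sub>R (e /\<^sub>R norm e)" using assms(2) by simp
  then have "e \<in> open_segment 0 (e /\<^sub>R norm e)"
    using lt assms(2) unfolding in_segment by (intro conjI exI[of _ "norm e"]) auto
  moreover have "e /\<^sub>R norm e \<in> cball 0 1" using assms(2) by simp
  ultimately show False using assms(1) unfolding extreme_point_of_def
    by (meson centre_in_cball zero_le_one)
qed

text \<open>The triangle inequality turns the bound into an equality, so that \<open>e\<close> is a convex combination of the
  normalised summands.\<close>

lemma extreme_point_summand:
  assumes e: "e extreme_point_of cball 0 1" "e \<noteq> 0"
    and sum: "e = a + b" and le: "norm a + norm b \<le> 1"
  shows "a = norm a *\<^sub>R e" "norm a + norm b = 1"
proof -
  have eq: "norm a + norm b = 1"
    using norm_triangle_ineq[of a b] norm_extreme_point_eq_1[OF e] sum le by simp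
  then show "norm a + norm b = 1" .
  show "a = norm a *\<^sub>R e"
  proof (cases "a = 0 \<or> b = 0")
    case False
    define a' b' where "a' = a /\<^sub>R norm a" and "b' = b /\<^sub>R norm b"
    have "a = norm a *\<^sub>R a'" "b = norm b *\<^sub>R b'" using False by (simp_all add: a'_def b'_def)
    moreover have "norm a = 1 - norm b" using eq by simp
    ultimately have conv: "e = (1 - norm b) *\<^sub>R a' + norm b *\<^sub>R b'" using sum by metis
    have "a' \<in> cball 0 1" "b' \<in> cball 0 1" using False by (auto simp: a'_def b'_def)
    then have "e \<notin> open_segment a' b'" using e by (simp add: extreme_point_of_def)
    moreover have "0 < norm a" "0 < norm b" using False by simp_all
    then have "0 < norm b" "norm b < 1" using eq by linarith+
    ultimately have "a' = b'" using conv by (auto simp: in_segment)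
    then have "e = a'" using conv by (simp flip: scaleR_add_left)
    then show ?thesis using \<open>a = norm a *\<^sub>R a'\<close> by simp
  qed (use sum eq in auto)
qed

text \<open>Let \<open>h\<close> represent \<open>e\<close>. Multiplying \<open>h\<close> by a measurable \<open>\<phi>\<close> with values in \<open>[0, 1]\<close> splits \<open>e\<close> into two summands
  with norms of sum 1, so by extremality \<open>\<phi>\<close> is constant on the support of \<open>h\<close>. Every real function can be
  squeezed injectively into \<open>[0, 1]\<close>; hence every integrable function is a multiple of \<open>h\<close>
  there, and restriction to the support of \<open>h\<close> is the desired L-projection.\<close>

lemma L_coefficient_extreme_point_L1:
  fixes T :: "'a::real_normed_vector dual \<Rightarrow> 'm \<Rightarrow> real"
    and e :: "'a dual"
  assumes T: "dual_isometry_onto_L1 T \<mu>"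
    and e: "e extreme_point_of cball 0 1" "e \<noteq> 0"
  obtains c where "L_coefficient e c"
proof -
  have int [simp, intro]: "integrable \<mu> (T f)" for f using T by (simp add: dual_isometry_onto_L1_def)
  then have meas [measurable]: "T f \<in> borel_measurable \<mu>" for f by blast
  have add: "AE t in \<mu>. T (f + g) t = T f t + T g t" for f g
    using T by (simp add: dual_isometry_onto_L1_def)
  have scale: "AE t in \<mu>. T (k *\<^sub>R f) t = k * T f t" for k f
    using T by (simp add: dual_isometry_onto_L1_def)
  have nT: "(LINT t|\<mu>. \<bar>T f t\<bar>) = norm f" for f using T by (simp add: dual_isometry_onto_L1_def)
  have diff: "AE t in \<mu>. T (f - k *\<^sub>R g) t = T f t - k * T g t" for f g k
    using add[of f "(- k) *\<^sub>R g"] scale[of "- k" g] by eventually_elim simp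
  have inj: "f = g" if "AE t in \<mu>. T f t = T g t" for f g
  proof -
    have "norm (f - 1 *\<^sub>R g) = (LINT t|\<mu>. \<bar>T (f - 1 *\<^sub>R g) t\<bar>)" by (rule nT[symmetric])
    also have "\<dots> = (LINT t|\<mu>. 0)"
      by (rule integral_cong_AE) (use diff[of f 1 g] that in \<open>auto elim: eventually_elim2\<close>)
    finally show ?thesis by simp
  qed
  define h where "h = T e"
  have [measurable]: "h \<in> borel_measurable \<mu>" and inth: "integrable \<mu> h" by (simp_all add: h_def)
  have normh: "(LINT t|\<mu>. \<bar>h t\<bar>) = 1" using nT[of e] norm_extreme_point_eq_1[OF e] by (simp add: h_def)
  have mult: "\<exists>k. AE t in \<mu>. \<phi> t * h t = k * h t"
    if [measurable]: "\<phi> \<in> borel_measurable \<mu>" and \<phi>: "\<And>t. 0 \<le> \<phi> t" "\<And>t. \<phi> t \<le> 1" for \<phi>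
  proof -
    have int1: "integrable \<mu> (\<lambda>t. \<phi> t * h t)"
      by (rule Bochner_Integration.integrable_bound[OF inth])
        (use \<phi> in \<open>auto simp: abs_mult intro!: AE_I2 mult_left_le_one_le\<close>)
    have int2: "integrable \<mu> (\<lambda>t. (1 - \<phi> t) * h t)"
      using Bochner_Integration.integrable_diff[OF inth int1] by (simp add: algebra_simps)
    obtain a where a: "AE t in \<mu>. T a t = \<phi> t * h t" using int1 T by (auto simp: dual_isometry_onto_L1_def)
    obtain b where b: "AE t in \<mu>. T b t = (1 - \<phi> t) * h t" using int2 T by (auto simp: dual_isometry_onto_L1_def)
    have "e = a + b"
      by (rule inj) (use add[of a b] a b in \<open>eventually_elim, simp add: h_def algebra_simps\<close>)
    moreover have "norm a + norm b = 1"
    proof -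
      have "norm a + norm b = (LINT t|\<mu>. \<bar>T a t\<bar> + \<bar>T b t\<bar>)" by (simp add: nT)
      also have "\<dots> = (LINT t|\<mu>. \<bar>h t\<bar>)"
      proof (rule integral_cong_AE)
        show "AE t in \<mu>. \<bar>T a t\<bar> + \<bar>T b t\<bar> = \<bar>h t\<bar>"
          using a b
        proof eventually_elim
          case (elim t)
          have "\<bar>\<phi> t * h t\<bar> = \<phi> t * \<bar>h t\<bar>" "\<bar>(1 - \<phi> t) * h t\<bar> = (1 - \<phi> t) * \<bar>h t\<bar>"
            using \<phi>(1)[of t] \<phi>(2)[of t] by (simp_all add: abs_mult)
          then have "\<bar>\<phi> t * h t\<bar> + \<bar>(1 - \<phi> t) * h t\<bar> = \<bar>h t\<bar>" by (simp add: algebra_simps)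
          with elim show ?case by simp
        qed
      qed auto
      finally show ?thesis by (simp add: normh)
    qed
    ultimately have "a = norm a *\<^sub>R e" using extreme_point_summand(1)[OF e] by simp
    then have "AE t in \<mu>. T a t = norm a * h t" using scale[of "norm a" e] by (simp add: h_def)
    with a have "AE t in \<mu>. \<phi> t * h t = norm a * h t" by eventually_elim metis
    then show ?thesis by blast
  qed
  have scalar: "\<exists>d. AE t in \<mu>. h t \<noteq> 0 \<longrightarrow> T f t = d * h t" for f
  proof -
    define r where "r t = T f t / h t" for t
    have [measurable]: "r \<in> borel_measurable \<mu>" unfolding r_def by measurable
    \<comment> \<open>The map \<open>r \<mapsto> r / (1 + \<bar>r\<bar>)\<close> is injective with inverse \<open>s \<mapsto> s / (1 - \<bar>s\<bar>)\<close>.\<close>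
    define \<phi> where "\<phi> t = (1 + r t / (1 + \<bar>r t\<bar>)) / 2" for t
    have "\<exists>k. AE t in \<mu>. \<phi> t * h t = k * h t"
    proof (rule mult)
      show "\<phi> \<in> borel_measurable \<mu>" unfolding \<phi>_def by measurable
      show "0 \<le> \<phi> t" "\<phi> t \<le> 1" for t by (auto simp: \<phi>_def field_simps abs_if)
    qed
    then obtain k where k: "AE t in \<mu>. \<phi> t * h t = k * h t" ..
    define s where "s = 2 * k - 1"
    from k have "AE t in \<mu>. h t \<noteq> 0 \<longrightarrow> T f t = s / (1 - \<bar>s\<bar>) * h t"
    proof eventually_elim
      case (elim t)
      show ?case
      proof
        assume "h t \<noteq> 0"
        with elim have s: "s = r t / (1 + \<bar>r t\<bar>)" by (simp add: \<phi>_def s_def)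
        have "1 - \<bar>s\<bar> = 1 / (1 + \<bar>r t\<bar>)" unfolding s by (simp add: abs_divide field_simps)
        then have "s / (1 - \<bar>s\<bar>) = r t" by (simp add: s)
        then show "T f t = s / (1 - \<bar>s\<bar>) * h t" using \<open>h t \<noteq> 0\<close> by (simp add: r_def)
      qed
    qed
    then show ?thesis by blast
  qed
  define c where "c f = (LINT t|\<mu>. T f t * sgn (h t))" for f
  have ints: "integrable \<mu> (\<lambda>t. T f t * sgn (h t))" for f
    by (rule Bochner_Integration.integrable_bound[OF int[of f]]) (auto simp: abs_mult sgn_real_def)
  have c: "AE t in \<mu>. h t \<noteq> 0 \<longrightarrow> T f t = c f * h t" for f
  proof -
    obtain d where d: "AE t in \<mu>. h t \<noteq> 0 \<longrightarrow> T f t = d * h t" using scalar by blast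
    have "c f = (LINT t|\<mu>. d * \<bar>h t\<bar>)"
      unfolding c_def
    proof (rule integral_cong_AE)
      show "AE t in \<mu>. T f t * sgn (h t) = d * \<bar>h t\<bar>"
        using d by eventually_elim (auto simp: sgn_real_def)
    qed auto
    then have "c f = d" by (simp add: normh)
    with d show ?thesis by simp
  qed
  have "L_coefficient e c"
    unfolding L_coefficient_def
  proof (intro conjI allI)
    show "linear c"
    proof (rule linearI)
      fix f g
      have "c (f + g) = (LINT t|\<mu>. T f t * sgn (h t) + T g t * sgn (h t))"
        unfolding c_def
        by (rule integral_cong_AE) (use add[of f g] in \<open>auto elim!: eventually_mono simp: algebra_simps\<close>)
      then show "c (f + g) = c f + c g" by (simp add: c_def ints)
    next
      fix k f
      have "c (k *\<^sub>R f) = (LINT t|\<mu>. k * (T f t * sgn (h t)))"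
        unfolding c_def
        by (rule integral_cong_AE) (use scale[of k f] in \<open>auto elim!: eventually_mono simp: algebra_simps\<close>)
      then show "c (k *\<^sub>R f) = k *\<^sub>R c f" by (simp add: c_def)
    qed
    show "norm e = 1" by (rule norm_extreme_point_eq_1[OF e])
    have "c e = (LINT t|\<mu>. \<bar>h t\<bar>)" unfolding c_def h_def[symmetric]
      by (rule Bochner_Integration.integral_cong) (auto simp: sgn_real_def)
    then show "c e = 1" by (simp add: normh)
    fix f
    have "norm f = (LINT t|\<mu>. \<bar>c f\<bar> * \<bar>h t\<bar> + \<bar>T (f - c f *\<^sub>R e) t\<bar>)"
      unfolding nT[of f, symmetric]
    proof (rule integral_cong_AE)
      show "AE t in \<mu>. \<bar>T f t\<bar> = \<bar>c f\<bar> * \<bar>h t\<bar> + \<bar>T (f - c f *\<^sub>R e) t\<bar>"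
        using c[of f] diff[of f "c f" e] by eventually_elim (auto simp: h_def abs_mult)
    qed auto
    also have "\<dots> = \<bar>c f\<bar> + norm (f - c f *\<^sub>R e)"
      using inth by (simp add: nT normh)
    finally show "norm f = \<bar>c f\<bar> + norm (f - c f *\<^sub>R e)" .
  qed
  then show thesis by (rule that)
qed

lemma L1_predual_GM_polyhedral_if_no_Delta_points:
  assumes "L1_predual TYPE('a::banach) \<mu>" and "(Delta_points :: 'a set) = {}"
  shows "GM_polyhedral TYPE('a)"
proof (rule GM_polyhedral_if_no_Delta_points[OF assms(2)])
  obtain T :: "'a dual \<Rightarrow> _" where T: "dual_isometry_onto_L1 T \<mu>"
    using assms(1) unfolding L1_predual_def by blast
  fix x :: 'a and \<delta> :: real
  assume \<delta>: "\<delta> < 1" and fin: "finite {p::'a dual. (\<exists>c. L_coefficient p c) \<and> 1 - \<delta> < blinfun_apply p x}"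
  show "finite {e::'a dual. e extreme_point_of cball 0 1 \<and> 1 - \<delta> < blinfun_apply e x}"
  proof (rule finite_subset[OF _ fin], rule subsetI)
    fix e :: "'a dual"
    assume "e \<in> {e. e extreme_point_of cball 0 1 \<and> 1 - \<delta> < blinfun_apply e x}"
    then have e: "e extreme_point_of cball 0 1" "1 - \<delta> < e x" by blast+
    then have "e \<noteq> 0" using \<delta> by auto
    then obtain c where "L_coefficient e c" using L_coefficient_extreme_point_L1[OF T e(1)] by blast
    then show "e \<in> {p. (\<exists>c. L_coefficient p c) \<and> 1 - \<delta> < blinfun_apply p x}" using e by blast
  qed
qed

section \<open>Nicely embedded spaces\<close>

lemma sublinear_max:
  assumes "sublinear p" "sublinear q"
  shows "sublinear (\<lambda>z. max (p z) (q z))"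
proof (rule sublinearI)
  show "max (p (x + y)) (q (x + y)) \<le> max (p x) (q x) + max (p y) (q y)" for x y
    using sublinear_add[OF assms(1), of x y] sublinear_add[OF assms(2), of x y] by linarith
  show "max (p (c *\<^sub>R x)) (q (c *\<^sub>R x)) \<le> c * max (p x) (q x)" if "0 < c" for c x
    using that by (auto simp: sublinear_scale[OF assms(1)] sublinear_scale[OF assms(2)])
  show "max (p 0) (q 0) = 0" by (simp add: sublinear_zero assms)
qed

text \<open>The inequality for \<open>a\<close> reads \<open>a (y - z) \<le> max (p y) (q z) - e z\<close>, so \<open>a\<close> has to lie below the infimum \<open>r u\<close> of the right-hand side
  over all \<open>y, z\<close> with \<open>y - z = u\<close>. This infimum is sublinear, and the
  hypothesis on \<open>e\<close> is what keeps it finite and makes \<open>r 0 = 0\<close>.\<close>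

lemma dominated_by_max_imp_split:
  fixes e :: "'a::real_normed_vector dual"
  assumes p: "sublinear p" and ple: "\<And>z. p z \<le> norm z"
    and q: "sublinear q" and qle: "\<And>z. q z \<le> norm z"
    and e: "\<And>z. e z \<le> max (p z) (q z)"
  shows "\<exists>a :: 'a dual. \<forall>y z. blinfun_apply a y + blinfun_apply (e - a) z \<le> max (p y) (q z)"
proof -
  define r where "r u = (INF z. max (p (u + z)) (q z) - e z)" for u
  have lower: "- norm u \<le> max (p (u + z)) (q z) - e z" for u z
  proof -
    have "p z \<le> p (u + z) + norm u"
      using sublinear_add[OF p, of "u + z" "- u"] ple[of "- u"] by simp
    with e[of z] norm_ge_zero[of u] show ?thesis by linarith
  qed
  have bdd: "bdd_below (range (\<lambda>z. max (p (u + z)) (q z) - e z))" for u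
    using lower by (rule bdd_belowI2)
  have r_le: "r u \<le> max (p (u + z)) (q z) - e z" for u z
    unfolding r_def by (rule cINF_lower[OF bdd]) simp
  have r_greatest: "a \<le> r u" if "\<And>z. a \<le> max (p (u + z)) (q z) - e z" for a u
    unfolding r_def by (rule cINF_greatest) (use that in auto)
  have r_approx: "\<exists>z. max (p (u + z)) (q z) - e z < a" if "r u < a" for a u
    using that r_greatest[of a u] by (meson not_le)
  have sub: "sublinear r"
  proof (rule sublinearI)
    fix u v
    show "r (u + v) \<le> r u + r v"
    proof (rule field_le_epsilon)
      fix \<epsilon> :: real assume "0 < \<epsilon>"
      obtain y where y: "max (p (u + y)) (q y) - e y < r u + \<epsilon> / 2"
        using r_approx[of u "r u + \<epsilon> / 2"] \<open>0 < \<epsilon>\<close> by auto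
      obtain z where z: "max (p (v + z)) (q z) - e z < r v + \<epsilon> / 2"
        using r_approx[of v "r v + \<epsilon> / 2"] \<open>0 < \<epsilon>\<close> by auto
      have "r (u + v) \<le> max (p ((u + y) + (v + z))) (q (y + z)) - e (y + z)"
        using r_le[of "u + v" "y + z"] by (simp add: algebra_simps)
      also have "\<dots> \<le> (max (p (u + y)) (q y) - e y) + (max (p (v + z)) (q z) - e z)"
        using sublinear_add[OF p, of "u + y" "v + z"] sublinear_add[OF q, of y z]
        by (simp add: blinfun.add_right max_def)
      finally show "r (u + v) \<le> r u + r v + \<epsilon>" using y z by simp
    qed
  next
    fix c :: real and u assume c: "0 < c"
    have "r (c *\<^sub>R u) / c \<le> r u"
    proof (rule r_greatest)
      fix z
      have "r (c *\<^sub>R u) \<le> max (p (c *\<^sub>R (u + z))) (q (c *\<^sub>R z)) - e (c *\<^sub>R z)"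
        using r_le[of "c *\<^sub>R u" "c *\<^sub>R z"] by (simp add: algebra_simps)
      also have "\<dots> = c * (max (p (u + z)) (q z) - e z)"
        using c by (simp only: sublinear_scale[OF p] sublinear_scale[OF q] blinfun.scaleR_right
            max_mult_distrib_left real_scaleR_def less_imp_le right_diff_distrib if_True)
      finally show "r (c *\<^sub>R u) / c \<le> max (p (u + z)) (q z) - e z" using c by (simp add: field_simps)
    qed
    then show "r (c *\<^sub>R u) \<le> c * r u" using c by (simp add: field_simps)
  next
    show "r 0 = 0"
    proof (rule antisym)
      show "r 0 \<le> 0" using r_le[of 0 0] sublinear_zero[OF p] sublinear_zero[OF q] by simp
      show "0 \<le> r 0" by (rule r_greatest) (use e in auto)
    qed
  qed
  have "r u \<le> norm u" for u
  proof -
    have "r u \<le> max (p u) 0" using r_le[of u 0] sublinear_zero[OF q] by simp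
    with ple[of u] norm_ge_zero[of u] show ?thesis by linarith
  qed
  then obtain a :: "'a dual" where a: "\<And>u. a u \<le> r u"
    using Hahn_Banach_sublinear[OF sub] by blast
  have "a y + blinfun_apply (e - a) z \<le> max (p y) (q z)" for y z
  proof -
    have "a (y - z) \<le> max (p y) (q z) - e z"
      using order_trans[OF a r_le[of "y - z" z]] by simp
    then show ?thesis by (simp add: blinfun.diff_right blinfun.diff_left)
  qed
  then show ?thesis by blast
qed

lemma norm_sum_le_1_if_split:
  fixes a b :: "'a::real_normed_vector dual"
  assumes "\<And>y z. a y + b z \<le> max (norm y) (norm z)"
  shows "norm a + norm b \<le> 1"
proof -
  have "norm b \<le> 1 - norm a"
  proof (rule norm_blinfun_le)
    fix z :: 'a assume z: "norm z \<le> 1"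
    have "norm a \<le> 1 - b z"
    proof (rule norm_blinfun_le)
      fix y :: 'a assume "norm y \<le> 1"
      with z assms[of y z] show "a y \<le> 1 - b z" by simp
    qed
    then show "b z \<le> 1 - norm a" by simp
  qed
  then show ?thesis by simp
qed

text \<open>The two arguments are translated by multiples of a vector \<open>w\<close> that almost norms \<open>e\<close>: \<open>y\<close> by \<open>s w\<close> with
  \<open>s\<close> so large that \<open>t\<close> is positive, and \<open>z = t w\<close>, with \<open>t = p y + s\<close> chosen such that both entries of the
  maximum are bounded by \<open>t\<close>. Then \<open>s\<close> cancels up to the error \<open>\<epsilon>\<close>.\<close>

lemma le_first_if_convex_split:
  fixes e :: "'a::real_normed_vector dual"
  assumes p: "sublinear p" and ple: "\<And>z. p z \<le> norm z" and qle: "\<And>z. q z \<le> norm z"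
    and e: "norm e = 1" and l: "0 < l" "l \<le> 1"
    and split: "\<And>y z. l * e y + (1 - l) * e z \<le> max (p y) (q z)"
  shows "e y \<le> p y"
proof -
  have "l * e y \<le> l * p y"
  proof (rule field_le_epsilon)
    fix \<epsilon> :: real assume \<epsilon>: "0 < \<epsilon>"
    define s where "s = \<bar>p y\<bar> + 1"
    define t where "t = p y + s"
    have st: "0 < s" "0 < t" by (auto simp: s_def t_def)
    define \<eta> where "\<eta> = \<epsilon> / (s + t)"
    have \<eta>: "0 < \<eta>" "(s + t) * \<eta> = \<epsilon>" using st \<epsilon> by (simp_all add: \<eta>_def)
    obtain w where w: "norm w \<le> 1" "1 - \<eta> < e w"
    proof (rule ccontr)
      assume "\<not> thesis"
      with that have "e w \<le> 1 - \<eta>" if "norm w \<le> 1" for w using that by force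
      then have "norm e \<le> 1 - \<eta>" by (rule norm_blinfun_le)
      with e \<eta> show False by simp
    qed
    have "p (y + s *\<^sub>R w) \<le> p y + s * 1"
    proof -
      have "p (y + s *\<^sub>R w) \<le> p y + s * p w"
        using sublinear_add[OF p, of y "s *\<^sub>R w"] sublinear_scale[OF p, of s w] st by simp
      moreover have "s * p w \<le> s * 1" using ple[of w] w st by (intro mult_left_mono) auto
      ultimately show ?thesis by simp
    qed
    moreover have "q (t *\<^sub>R w) \<le> t"
    proof -
      have "q (t *\<^sub>R w) \<le> t * norm w" using qle[of "t *\<^sub>R w"] st by simp
      also have "\<dots> \<le> t" using w st by (simp add: mult_left_le)
      finally show ?thesis .
    qed
    ultimately have "l * e (y + s *\<^sub>R w) + (1 - l) * e (t *\<^sub>R w) \<le> t"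
      using split[of "y + s *\<^sub>R w" "t *\<^sub>R w"] by (simp add: t_def)
    then have 1: "l * e y + (l * s) * e w + ((1 - l) * t) * e w \<le> t"
      by (simp add: blinfun.add_right blinfun.scaleR_right algebra_simps)
    have "(l * s) * (1 - \<eta>) \<le> (l * s) * e w" "((1 - l) * t) * (1 - \<eta>) \<le> ((1 - l) * t) * e w"
      using w l st by (intro mult_left_mono; simp)+
    with 1 have "l * e y \<le> t - (l * s + (1 - l) * t) + (l * s + (1 - l) * t) * \<eta>"
      by (simp add: algebra_simps)
    also have "t - (l * s + (1 - l) * t) = l * p y" by (simp add: t_def algebra_simps)
    also have "(l * s + (1 - l) * t) * \<eta> \<le> (s + t) * \<eta>"
      using l st \<eta> by (intro mult_right_mono add_mono) (auto simp: mult_le_cancel_right2 mult_left_le_one_le)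
    finally show "l * e y \<le> l * p y + \<epsilon>" using \<eta>(2) by simp
  qed
  with l show ?thesis by simp
qed

text \<open>In terms of the sets described by \<open>p\<close> and \<open>q\<close>: an extreme point in the convex hull of the union
  of two compact convex sets belongs to one of them. Extremality makes the two summands of
  the splitting proportional to \<open>e\<close>, and at least one coefficient is positive.\<close>

proposition extreme_point_dominated_by_max:
  fixes e :: "'a::real_normed_vector dual"
  assumes e: "e extreme_point_of cball 0 1" "e \<noteq> 0"
    and p: "sublinear p" and ple: "\<And>z. p z \<le> norm z"
    and q: "sublinear q" and qle: "\<And>z. q z \<le> norm z"
    and le: "\<And>z. e z \<le> max (p z) (q z)"
  shows "(\<forall>z. e z \<le> p z) \<or> (\<forall>z. e z \<le> q z)"
proof -
  obtain a :: "'a dual" where a: "\<And>y z. a y + (e - a) z \<le> max (p y) (q z)"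
    using dominated_by_max_imp_split[OF p ple q qle le] by blast
  have "norm a + norm (e - a) \<le> 1"
    by (rule norm_sum_le_1_if_split) (use a ple qle in \<open>meson max.mono order_trans\<close>)
  from extreme_point_summand[OF e _ this]
  have ae: "a = norm a *\<^sub>R e" and sum: "norm a + norm (e - a) = 1" by simp_all
  define l where "l = norm a"
  have "0 \<le> l" by (simp add: l_def)
  have "l \<le> 1" using sum norm_ge_zero[of "e - a"] unfolding l_def by linarith
  note l = \<open>0 \<le> l\<close> \<open>l \<le> 1\<close>
  have ae': "a = l *\<^sub>R e" using ae by (simp add: l_def)
  have split: "l * e y + (1 - l) * e z \<le> max (p y) (q z)" for y z
    using a[of y z] by (simp add: ae' blinfun.diff_left blinfun.scaleR_left algebra_simps)
  note ne = norm_extreme_point_eq_1[OF e]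
  show ?thesis
  proof (cases "0 < l")
    case True
    then show ?thesis using le_first_if_convex_split[OF p ple qle ne _ _ split] l by blast
  next
    case False
    then have "0 < 1 - l" "1 - l \<le> 1" using l by auto
    moreover have "(1 - l) * e y + (1 - (1 - l)) * e z \<le> max (q y) (p z)" for y z
      using split[of z y] by (simp add: max.commute add.commute)
    ultimately show ?thesis using le_first_if_convex_split[OF q qle ple ne] by blast
  qed
qed

definition support :: "'a::real_normed_vector dual set \<Rightarrow> 'a \<Rightarrow> real" where
  "support A z = (SUP f\<in>A. blinfun_apply f z)"

context
  fixes A :: "'a::real_normed_vector dual set"
  assumes A: "A \<subseteq> cball 0 1" "A \<noteq> {}"
begin

lemma bdd_above_support: "bdd_above ((\<lambda>f. blinfun_apply f z) ` A)"
  by (rule bdd_aboveI2[where M = "norm z"]) (use A blinfun_le_norm in blast)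

lemma support_upper: "f \<in> A \<Longrightarrow> f z \<le> support A z"
  unfolding support_def by (rule cSUP_upper[OF _ bdd_above_support])

lemma support_least: "(\<And>f. f \<in> A \<Longrightarrow> f z \<le> b) \<Longrightarrow> support A z \<le> b"
  unfolding support_def by (rule cSUP_least[OF A(2)])

lemma support_le_norm: "support A z \<le> norm z"
  by (rule support_least) (use A blinfun_le_norm in blast)

lemma sublinear_support: "sublinear (support A)"
proof (rule sublinearI)
  show "support A (x + y) \<le> support A x + support A y" for x y
    by (rule support_least) (simp add: blinfun.add_right add_mono support_upper)
  show "support A (c *\<^sub>R x) \<le> c * support A x" if "0 < c" for c x
    by (rule support_least) (use that in \<open>simp add: blinfun.scaleR_right support_upper\<close>)
  show "support A 0 = 0" using A(2) by (simp add: support_def)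
qed

end

text \<open>The points of \<open>F\<close> are split off one at a time, each being the only functional dominated by
  itself.\<close>

lemma extreme_point_dominated_by_support:
  fixes A :: "'a::real_normed_vector dual set" and e :: "'a dual"
  assumes e: "e extreme_point_of cball 0 1" "e \<noteq> 0"
    and A: "A \<subseteq> cball 0 1" "A \<noteq> {}" and F: "finite F" "F \<subseteq> cball 0 1"
    and le: "\<And>z. e z \<le> support (F \<union> A) z"
  shows "e \<in> F \<or> (\<forall>z. e z \<le> support A z)"
  using F le
proof (induction F)
  case (insert p F)
  have FA: "F \<union> A \<subseteq> cball 0 1" "F \<union> A \<noteq> {}" using insert.prems A by auto
  have p: "p \<in> cball 0 1" using insert.prems by simp
  have "e z \<le> max (p z) (support (F \<union> A) z)" for z
  proof -
    have "support (insert p F \<union> A) z \<le> max (p z) (support (F \<union> A) z)"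
      by (rule support_least)
        (use FA p in \<open>auto simp: le_max_iff_disj intro: support_upper[OF FA]\<close>)
    with insert.prems(2)[of z] show ?thesis by simp
  qed
  then consider "\<forall>z. e z \<le> p z" | "\<forall>z. e z \<le> support (F \<union> A) z"
    using extreme_point_dominated_by_max[OF e sublinear_blinfun blinfun_le_norm[OF p]
        sublinear_support[OF FA] support_le_norm[OF FA]] by blast
  then show ?case
  proof cases
    case 1
    then have "e = p" by (auto intro: blinfun_eq_if_le)
    then show ?thesis by simp
  next
    case 2
    with insert show ?thesis by auto
  qed
qed simp

text \<open>Members of \<open>N\<close> outside the finite set are at most \<open>b\<close> at \<open>x\<close>, so an extreme point above \<open>b\<close> cannot be
  dominated by their support functional and is one of the finitely many others. Adding 0 to
  them keeps the supremum over a nonempty set, and is harmless as \<open>b \<ge> 0\<close>.\<close>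

lemma extreme_points_subset_if_finite_norming:
  fixes N :: "'a::real_normed_vector dual set"
  assumes N: "N \<subseteq> cball 0 1" and norming: "\<And>z b. (\<And>f. f \<in> N \<Longrightarrow> f z \<le> b) \<Longrightarrow> 0 \<le> b \<Longrightarrow> norm z \<le> b"
    and fin: "finite {p\<in>N. b < blinfun_apply p x}" and b: "0 \<le> b"
  shows "{e::'a dual. e extreme_point_of cball 0 1 \<and> b < blinfun_apply e x} \<subseteq> {p\<in>N. b < blinfun_apply p x}"
proof (rule subsetI)
  fix e :: "'a dual"
  assume "e \<in> {e. e extreme_point_of cball 0 1 \<and> b < blinfun_apply e x}"
  then have e: "e extreme_point_of cball 0 1" and ex: "b < blinfun_apply e x" by blast+
  then have e0: "e \<noteq> 0" using b by auto
  define F where "F = {p\<in>N. b < blinfun_apply p x}"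
  define A where "A = insert 0 (N - F)"
  have A: "A \<subseteq> cball 0 1" "A \<noteq> {}" using N by (auto simp: A_def)
  have F: "finite F" "F \<subseteq> cball 0 1" using N fin by (auto simp: F_def)
  have FA: "F \<union> A \<subseteq> cball 0 1" "F \<union> A \<noteq> {}" using F A by auto
  have "e z \<le> support (F \<union> A) z" for z
  proof -
    have "norm z \<le> support (F \<union> A) z"
      by (rule norming) (use support_upper[OF FA, of _ z] support_upper[OF FA, of 0 z] in \<open>auto simp: A_def\<close>)
    moreover have "e z \<le> norm z" using e by (intro blinfun_le_norm) (simp add: extreme_point_of_def)
    ultimately show ?thesis by simp
  qed
  then have "e \<in> F \<or> (\<forall>z. e z \<le> support A z)"
    by (rule extreme_point_dominated_by_support[OF e e0 A F])
  moreover have "support A x \<le> b"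
    by (rule support_least[OF A]) (use b in \<open>auto simp: A_def F_def\<close>)
  ultimately have "e \<in> F" using ex by (meson not_le order_trans)
  then show "e \<in> {p\<in>N. b < blinfun_apply p x}" by (simp add: F_def)
qed

lemma L_coefficient_minus:
  assumes "L_coefficient p c"
  shows "L_coefficient (- p) (\<lambda>v. - c v)"
proof -
  note c = L_coefficientD[OF assms]
  have "linear (\<lambda>v. - c v)" by (rule linear_compose_neg[OF c(1)])
  moreover have "norm (- p) = 1" "- c (- p) = 1" using c(2,3) linear_neg[OF c(1), of p] by simp_all
  moreover have "norm v = \<bar>- c v\<bar> + norm (v - (- c v) *\<^sub>R (- p))" for v
    using c(4)[of v] unfolding abs_minus_cancel scaleR_minus_left scaleR_minus_right minus_minus .
  ultimately show ?thesis unfolding L_coefficient_def by (intro conjI allI)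
qed

lemma nicely_embedded_GM_polyhedral_if_no_Delta_points:
  fixes J :: "'a::banach \<Rightarrow>\<^sub>L ('s::t2_space \<Rightarrow>\<^sub>C real)"
  assumes J: "nice_embedding J" and "(Delta_points :: 'a set) = {}"
  shows "GM_polyhedral TYPE('a)"
proof (rule GM_polyhedral_if_no_Delta_points[OF assms(2)])
  fix x :: 'a and \<delta> :: real
  assume \<delta>: "0 < \<delta>" "\<delta> < 1" and fin: "finite {p::'a dual. (\<exists>c. L_coefficient p c) \<and> 1 - \<delta> < blinfun_apply p x}"
  define N where "N = {p :: 'a dual. \<exists>c. L_coefficient p c}"
  have pull: "pullback_dirac J s z = apply_bcontfun (J z) s" for s z
    by (simp add: pullback_dirac_def dirac.rep_eq)
  have "\<exists>c. L_coefficient (pullback_dirac J s) c" for s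
    using J L_coefficient_if_L_summand unfolding nice_embedding_def by metis
  then have mem: "pullback_dirac J s \<in> N" "- pullback_dirac J s \<in> N" for s
    unfolding N_def using L_coefficient_minus by blast+
  have "{e::'a dual. e extreme_point_of cball 0 1 \<and> 1 - \<delta> < blinfun_apply e x} \<subseteq> {p\<in>N. 1 - \<delta> < blinfun_apply p x}"
  proof (rule extreme_points_subset_if_finite_norming)
    show "N \<subseteq> cball 0 1" by (auto simp: N_def dest: L_coefficientD(2))
    show "finite {p\<in>N. 1 - \<delta> < blinfun_apply p x}" using fin by (simp add: N_def)
    show "0 \<le> 1 - \<delta>" using \<delta> by simp
    fix z b assume b: "\<And>f. f \<in> N \<Longrightarrow> blinfun_apply f z \<le> b" 
    have "\<bar>apply_bcontfun (J z) s\<bar> \<le> b" for s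
      using b[OF mem(1)[of s]] b[OF mem(2)[of s]] by (simp add: pull blinfun.minus_left)
    then have "norm (J z) \<le> b" by (intro norm_bound) simp
    then show "norm z \<le> b" using J by (simp add: nice_embedding_def)
  qed
  then show "finite {e::'a dual. e extreme_point_of cball 0 1 \<and> 1 - \<delta> < blinfun_apply e x}"
    by (rule finite_subset) (use fin in \<open>simp add: N_def\<close>)
qed

theorem corollary3p8:
  shows "(GM_polyhedral TYPE('a::banach) \<longrightarrow> (Delta_points :: 'a set) = {}) \<and>
    ((\<exists>\<mu> :: 'm measure. L1_predual TYPE('a) \<mu>) \<longrightarrow>
       (GM_polyhedral TYPE('a) \<longleftrightarrow> (Delta_points :: 'a set) = {})) \<and>
    ((\<exists>J :: 'a \<Rightarrow>\<^sub>L ('s::t2_space \<Rightarrow>\<^sub>C real).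
        nice_embedding J \<and> pairwise_lin_indep (pullback_dirac J)) \<longrightarrow>
       (GM_polyhedral TYPE('a) \<longleftrightarrow> (Delta_points :: 'a set) = {}))"
  using GM_polyhedral_imp_no_Delta_points[where 'a='a]
    L1_predual_GM_polyhedral_if_no_Delta_points[where 'a='a and 'b='m]
    nicely_embedded_GM_polyhedral_if_no_Delta_points[where 'a='a and 's='s]
  by blast

end
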